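(* Let $D$ be a countable solid digraph. Then the following are equivalent: (i) $D$ is strongly connected; (ii) there is a closed directed topological path in $|D|$ whose image contains all the vertices of $D$.
   Context: Digraphs have no loops and no parallel edges. $\mathcal{X}(D)$: finite subsets of $V(D)$. $D$ is solid if $D-X$ has only finitely many strong components for every $X\in\mathcal{X}(D)$. Ends and limit edges: rays are one-way infinite directed paths, tails are subrays; a ray is solid if for each $X\in\mathcal{X}(D)$ it has a tail in a strong component of $D-X$; solid rays are equivalent if for each $X$ they have tails in the same strong component; classes are ends, $\Omega(D)$. $C(X,\omega)$: strong component of $D-X$ containing tails of rays of $\omega$ ($\omega$ lives in it); $X$ separates ends $\omega,\eta$ if $C(X,\omega)\ne C(X,\eta)$. For distinct ends, $(\omega,\eta)$ is a limit edge (tail $\omega$, head $\eta$) if for each $X$ separating them $D$ has an edge from $C(X,\omega)$ to $C(X,\eta)$; for a vertex $v$, $(v,\omega)$ (resp. $(\omega,v)$) is a limit edge if $D$ has an edge from $v$ to $C(X,\omega)$ (resp. from $C(X,\omega)$ to $v$) for all $X$ with $v\notin C(X,\omega)$. $\Lambda(D)$: limit edges. $|D|$: from $V(D)\cup\Omega(D)$ and copies $[0,1]_e$, $e\in E(D)\cup\Lambda(D)$, identify the tail of $e$ with $0$ and head with $1$ (the edges of $|D|$); points on different edges correspond if they come from the same real. A limit edge lives in a strong component $C$ of $D-X$ if each endpoint is a vertex of or an end living in $C$. Topology generated by: (1) open $\varepsilon$-stars around vertices; (2) open subintervals of interiors of edges of $D$; (3) for an end $\omega$ and $X\in\mathcal{X}(D)$,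 $\hat C_\varepsilon(X,\omega)$: vertices and inner points of edges of $C(X,\omega)$, ends living in $C(X,\omega)$, points of limit edges living in $C(X,\omega)$, and for each edge of $E(D)\cup\Lambda(D)$ with exactly one endpoint $y$ a vertex of/end living in $C(X,\omega)$, the half-open segment of length $\varepsilon$ at $y$; (4) for an inner point $z$ of a limit edge $(\omega,\eta)$ and $X$ separating $\omega,\eta$: union of open $\varepsilon$-intervals around points corresponding to $z$ on all edges of $D$ from $C(X,\omega)$ to $C(X,\eta)$ and on limit edges with tail a vertex of/end living in $C(X,\omega)$ and head a vertex of/end living in $C(X,\eta)$; for $(v,\omega)$ with $v\in X$ analogously over edges of $D$ from $v$ to $C(X,\omega)$ and limit edges $(v,\omega')$, $\omega'$ living in $C(X,\omega)$; symmetrically for $(\omega,v)$. A directed topological path is a continuous $\alpha\colon[0,1]\to|D|$ such that for every $x\in(0,1)$ mapped to an inner point of an edge $e$ of $|D|$ there is a neighbourhood $(a,b)$ of $x$ on which $\alpha$ is a homeomorphism onto the interior of $e$, and on each such $[a,b]$ it is order preserving with respect to $[0,1]_e$. It is closed if $\alpha(0)=\alpha(1)$. *)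

theory Defs
  imports "HOL-Analysis.Analysis"
begin

section \<open>Digraphs, strong components, solidity\<close>

text \<open>A digraph is given by a vertex set V and an edge relation E; no loops,
  and no parallel edges (automatic for a relation).\<close>
definition digraph :: "'v set \<Rightarrow> ('v \<times> 'v) set \<Rightarrow> bool" where
  "digraph V E \<longleftrightarrow> E \<subseteq> V \<times> V \<and> (\<forall>v. (v, v) \<notin> E)"

definition strongly_connected :: "'v set \<Rightarrow> ('v \<times> 'v) set \<Rightarrow> bool" where
  "strongly_connected V E \<longleftrightarrow> (\<forall>u\<in>V. \<forall>v\<in>V. (u, v) \<in> E\<^sup>*)"

text \<open>Mutual reachability inside the induced subdigraph on S.\<close>
definition sreach :: "('v \<times> 'v) set \<Rightarrow> 'v set \<Rightarrow> 'v \<Rightarrow> 'v \<Rightarrow> bool" where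
  "sreach E S u v \<longleftrightarrow> (u, v) \<in> (E \<inter> S \<times> S)\<^sup>* \<and> (v, u) \<in> (E \<inter> S \<times> S)\<^sup>*"

text \<open>Strong components of the subdigraph induced by S (for D - X take S = V - X).\<close>
definition strong_components :: "'v set \<Rightarrow> ('v \<times> 'v) set \<Rightarrow> 'v set set" where
  "strong_components S E = {{v \<in> S. sreach E S u v} | u. u \<in> S}"

definition solid :: "'v set \<Rightarrow> ('v \<times> 'v) set \<Rightarrow> bool" where
  "solid V E \<longleftrightarrow> (\<forall>X. finite X \<and> X \<subseteq> V \<longrightarrow> finite (strong_components (V - X) E))"

section \<open>Rays and ends\<close>

definition ray :: "'v set \<Rightarrow> ('v \<times> 'v) set \<Rightarrow> (nat \<Rightarrow> 'v) \<Rightarrow> bool" where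
  "ray V E r \<longleftrightarrow> inj r \<and> (\<forall>n. r n \<in> V \<and> (r n, r (Suc n)) \<in> E)"

text \<open>r has a tail in C.\<close>
definition tail_in :: "(nat \<Rightarrow> 'v) \<Rightarrow> 'v set \<Rightarrow> bool" where
  "tail_in r C \<longleftrightarrow> (\<exists>k. \<forall>n\<ge>k. r n \<in> C)"

definition solid_ray :: "'v set \<Rightarrow> ('v \<times> 'v) set \<Rightarrow> (nat \<Rightarrow> 'v) \<Rightarrow> bool" where
  "solid_ray V E r \<longleftrightarrow> ray V E r \<and>
     (\<forall>X. finite X \<and> X \<subseteq> V \<longrightarrow> (\<exists>C\<in>strong_components (V - X) E. tail_in r C))"

definition equiv_rays :: "'v set \<Rightarrow> ('v \<times> 'v) set \<Rightarrow> (nat \<Rightarrow> 'v) \<Rightarrow> (nat \<Rightarrow> 'v) \<Rightarrow> bool" where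
  "equiv_rays V E r s \<longleftrightarrow> solid_ray V E r \<and> solid_ray V E s \<and>
     (\<forall>X. finite X \<and> X \<subseteq> V \<longrightarrow>
        (\<exists>C\<in>strong_components (V - X) E. tail_in r C \<and> tail_in s C))"

definition ends :: "'v set \<Rightarrow> ('v \<times> 'v) set \<Rightarrow> (nat \<Rightarrow> 'v) set set" where
  "ends V E = {{s. equiv_rays V E r s} | r. solid_ray V E r}"

text \<open>C(X,\<omega>): the strong component of D - X containing tails of rays of \<omega>.\<close>
definition comp_of :: "'v set \<Rightarrow> ('v \<times> 'v) set \<Rightarrow> 'v set \<Rightarrow> (nat \<Rightarrow> 'v) set \<Rightarrow> 'v set" where
  "comp_of V E X \<omega> = (THE C. C \<in> strong_components (V - X) E \<and> (\<exists>r\<in>\<omega>. tail_in r C))"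

section \<open>Vertices/ends, limit edges\<close>

datatype 'v vend = Vx 'v | En "(nat \<Rightarrow> 'v) set"

text \<open>y is a vertex of C, or an end living in C (w.r.t. the separator X).\<close>
definition lives_in :: "'v set \<Rightarrow> ('v \<times> 'v) set \<Rightarrow> 'v set \<Rightarrow> 'v vend \<Rightarrow> 'v set \<Rightarrow> bool" where
  "lives_in V E X y C \<longleftrightarrow>
     (case y of Vx v \<Rightarrow> v \<in> C | En \<omega> \<Rightarrow> \<omega> \<in> ends V E \<and> comp_of V E X \<omega> = C)"

definition limit_edges :: "'v set \<Rightarrow> ('v \<times> 'v) set \<Rightarrow> ('v vend \<times> 'v vend) set" where
  "limit_edges V E =
     {(En \<omega>, En \<eta>) | \<omega> \<eta>. \<omega> \<in> ends V E \<and> \<eta> \<in> ends V E \<and> \<omega> \<noteq> \<eta> \<and>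
        (\<forall>X. finite X \<and> X \<subseteq> V \<and> comp_of V E X \<omega> \<noteq> comp_of V E X \<eta> \<longrightarrow>
           (\<exists>u\<in>comp_of V E X \<omega>. \<exists>w\<in>comp_of V E X \<eta>. (u, w) \<in> E))}
   \<union> {(Vx v, En \<omega>) | v \<omega>. v \<in> V \<and> \<omega> \<in> ends V E \<and>
        (\<forall>X. finite X \<and> X \<subseteq> V \<and> v \<notin> comp_of V E X \<omega> \<longrightarrow>
           (\<exists>w\<in>comp_of V E X \<omega>. (v, w) \<in> E))}
   \<union> {(En \<omega>, Vx v) | v \<omega>. v \<in> V \<and> \<omega> \<in> ends V E \<and>
        (\<forall>X. finite X \<and> X \<subseteq> V \<and> v \<notin> comp_of V E X \<omega> \<longrightarrow>
           (\<exists>w\<in>comp_of V E X \<omega>. (w, v) \<in> E))}"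

text \<open>All edges of |D|: edges of D and limit edges, indexed by (tail, head).\<close>
definition all_edges :: "'v set \<Rightarrow> ('v \<times> 'v) set \<Rightarrow> ('v vend \<times> 'v vend) set" where
  "all_edges V E = {(Vx u, Vx w) | u w. (u, w) \<in> E} \<union> limit_edges V E"

section \<open>The space |D|\<close>

text \<open>Points of |D|: vertices/ends, and inner points (parameter in (0,1)) of edges.\<close>
datatype 'v point = Pt "'v vend" | Inner "'v vend" "'v vend" real

definition star_set :: "'v set \<Rightarrow> ('v \<times> 'v) set \<Rightarrow> 'v \<Rightarrow> real \<Rightarrow> 'v point set" where
  "star_set V E v \<epsilon> = {Pt (Vx v)} \<union>
     {Inner a b t | a b t. (a, b) \<in> all_edges V E \<and> 0 < t \<and> t < 1 \<and>
        ((a = Vx v \<and> t < \<epsilon>) \<or> (b = Vx v \<and> 1 - \<epsilon> < t))}"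

definition end_nbhd :: "'v set \<Rightarrow> ('v \<times> 'v) set \<Rightarrow> 'v set \<Rightarrow> (nat \<Rightarrow> 'v) set \<Rightarrow> real \<Rightarrow> 'v point set" where
  "end_nbhd V E X \<omega> \<epsilon> =
     (let C = comp_of V E X \<omega>; L = (\<lambda>y. lives_in V E X y C) in
      {Pt y | y. L y} \<union>
      {Inner a b t | a b t. (a, b) \<in> all_edges V E \<and> 0 < t \<and> t < 1 \<and>
         ((L a \<and> L b) \<or> (L a \<and> \<not> L b \<and> t < \<epsilon>) \<or> (\<not> L a \<and> L b \<and> 1 - \<epsilon> < t))})"

definition lim_nbhd :: "'v set \<Rightarrow> ('v \<times> 'v) set \<Rightarrow> 'v vend set \<Rightarrow> 'v vend set \<Rightarrow> real \<Rightarrow> real \<Rightarrow> 'v point set" where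
  "lim_nbhd V E A B t \<epsilon> =
     {Inner a b s | a b s. (a, b) \<in> all_edges V E \<and> a \<in> A \<and> b \<in> B \<and> 0 < s \<and> s < 1 \<and> \<bar>s - t\<bar> < \<epsilon>}"

definition liv :: "'v set \<Rightarrow> ('v \<times> 'v) set \<Rightarrow> 'v set \<Rightarrow> (nat \<Rightarrow> 'v) set \<Rightarrow> 'v vend set" where
  "liv V E X \<omega> = {y. lives_in V E X y (comp_of V E X \<omega>)}"

definition gen_sets :: "'v set \<Rightarrow> ('v \<times> 'v) set \<Rightarrow> 'v point set set" where
  "gen_sets V E =
     {star_set V E v \<epsilon> | v \<epsilon>. v \<in> V \<and> 0 < \<epsilon>}
   \<union> {{Inner (Vx u) (Vx w) t | t. p < t \<and> t < q} | u w p q. (u, w) \<in> E \<and> 0 \<le> p \<and> p < q \<and> q \<le> 1}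
   \<union> {end_nbhd V E X \<omega> \<epsilon> | X \<omega> \<epsilon>. \<omega> \<in> ends V E \<and> finite X \<and> X \<subseteq> V \<and> 0 < \<epsilon>}
   \<union> {lim_nbhd V E (liv V E X \<omega>) (liv V E X \<eta>) t \<epsilon> | X \<omega> \<eta> t \<epsilon>.
        (En \<omega>, En \<eta>) \<in> limit_edges V E \<and> finite X \<and> X \<subseteq> V \<and>
        comp_of V E X \<omega> \<noteq> comp_of V E X \<eta> \<and> 0 < t \<and> t < 1 \<and> 0 < \<epsilon>}
   \<union> {lim_nbhd V E {Vx v} (liv V E X \<omega>) t \<epsilon> | X v \<omega> t \<epsilon>.
        (Vx v, En \<omega>) \<in> limit_edges V E \<and> finite X \<and> X \<subseteq> V \<and> v \<in> X \<and>
        0 < t \<and> t < 1 \<and> 0 < \<epsilon>}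
   \<union> {lim_nbhd V E (liv V E X \<omega>) {Vx v} t \<epsilon> | X v \<omega> t \<epsilon>.
        (En \<omega>, Vx v) \<in> limit_edges V E \<and> finite X \<and> X \<subseteq> V \<and> v \<in> X \<and>
        0 < t \<and> t < 1 \<and> 0 < \<epsilon>}"

definition DTop :: "'v set \<Rightarrow> ('v \<times> 'v) set \<Rightarrow> 'v point topology" where
  "DTop V E = topology_generated_by (gen_sets V E)"

section \<open>Directed topological paths\<close>

text \<open>The closed edge [0,1]_e of e = (a,b), parametrised.\<close>
definition edge_param :: "'v vend \<Rightarrow> 'v vend \<Rightarrow> real \<Rightarrow> 'v point" where
  "edge_param a b s = (if s = 0 then Pt a else if s = 1 then Pt b else Inner a b s)"

definition edge_interior :: "'v vend \<Rightarrow> 'v vend \<Rightarrow> 'v point set" where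
  "edge_interior a b = {Inner a b s | s. 0 < s \<and> s < 1}"

definition homeo_nbhd :: "'v set \<Rightarrow> ('v \<times> 'v) set \<Rightarrow> (real \<Rightarrow> 'v point) \<Rightarrow> real \<Rightarrow> 'v vend \<Rightarrow> 'v vend \<Rightarrow> real \<Rightarrow> real \<Rightarrow> bool" where
  "homeo_nbhd V E \<alpha> x a b c d \<longleftrightarrow> 0 \<le> c \<and> c < x \<and> x < d \<and> d \<le> 1 \<and>
     homeomorphic_map (top_of_set {c<..<d}) (subtopology (DTop V E) (edge_interior a b)) \<alpha>"

definition dtop_path :: "'v set \<Rightarrow> ('v \<times> 'v) set \<Rightarrow> (real \<Rightarrow> 'v point) \<Rightarrow> bool" where
  "dtop_path V E \<alpha> \<longleftrightarrow> continuous_map (top_of_set {0..1}) (DTop V E) \<alpha> \<and>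
     (\<forall>x\<in>{0<..<1}. \<forall>a b t. (a, b) \<in> all_edges V E \<and> 0 < t \<and> t < 1 \<and> \<alpha> x = Inner a b t \<longrightarrow>
        (\<exists>c d. homeo_nbhd V E \<alpha> x a b c d) \<and>
        (\<forall>c d. homeo_nbhd V E \<alpha> x a b c d \<longrightarrow>
           (\<exists>f. mono_on {c..d} f \<and> f ` {c..d} \<subseteq> {0..1} \<and>
                (\<forall>s\<in>{c..d}. \<alpha> s = edge_param a b (f s)))))"

end

theory Submission
  imports Defs
begin

text \<open>
  If some vertex u cannot reach some vertex v, let A be the set of vertices reachable from u.
  No edge of D, hence no limit edge, leaves the part of |D| belonging to A, so the function that
  is 1 on that part, 0 on the other one and interpolates linearly along the crossing edges is
  continuous and never decreases along a directed topological path. A closed path therefore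
  cannot visit both sides.

  Conversely, enumerate V and let \<open>X n\<close> consist of the first n vertices. Solidity makes the
  partition of V into the singletons of \<open>X n\<close> and the strong components of \<open>D - X n\<close> finite.
  Start with the trivial walk at the first vertex; in step n replace each visit of a vertex c by a
  closed walk at c that stays inside the class of c in the n-th partition and meets every class of
  the next partition contained in it. Nesting the corresponding time intervals, every time either
  eventually lies inside an edge, or eventually lies in an interval assigned to a vertex of some
  \<open>X n\<close>, or determines a decreasing sequence of strong components, hence an end. The resulting
  path only uses edges of D, never limit edges.
\<close>

section \<open>Strong components and ends\<close>

text \<open>Continuity of the closed path is not obtained by letting time intervals shrink. At a
  time mapped to an end, a neighbourhood of the end is given by a finite set contained in some
  \<open>X n\<close>, and the path maps the whole stage-n interval around that time into it. On the
  interval of a vertex of \<open>X n\<close> the path is constant, and beyond it lies an edge or the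
  boundary of [0,1]. This dictates the inserted walks. They stay in their class, so that nested
  intervals follow a decreasing sequence of components. They start and end at the same vertex c, so
  that edges placed earlier keep their endpoints and a time mapped to an end is never an interval
  boundary. They meet all subclasses because a vertex of \<open>X n\<close> is a class of its own at
  stage n: visiting all classes at all stages visits all vertices. In the other direction, the
  linear potential is continuous because a basic neighbourhood can be chosen so that corresponding
  endpoints of its edges lie on the same side of the cut.\<close>

lemma sreach_refl: "sreach E S u u"
  by (simp add: sreach_def)

lemma sreach_sym: "sreach E S u v \<Longrightarrow> sreach E S v u"
  by (simp add: sreach_def)

lemma sreach_trans: "sreach E S u v \<Longrightarrow> sreach E S v w \<Longrightarrow> sreach E S u w"
  unfolding sreach_def by (auto intro: rtrancl_trans)

lemma sreach_mono: assumes "S \<subseteq> T" "sreach E S u v" shows "sreach E T u v"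
proof -
  have "(E \<inter> S \<times> S)\<^sup>* \<subseteq> (E \<inter> T \<times> T)\<^sup>*" using assms(1) by (intro rtrancl_mono) auto
  then show ?thesis using assms(2) unfolding sreach_def by blast
qed

lemma strong_component_eq:
  assumes "C \<in> strong_components S E" and "v \<in> C"
  shows "C = {w \<in> S. sreach E S v w}"
proof -
  obtain u where u: "C = {w \<in> S. sreach E S u w}"
    using assms(1) unfolding strong_components_def by blast
  then have "sreach E S u v" using assms(2) by simp
  then have "sreach E S u w \<longleftrightarrow> sreach E S v w" for w
    by (meson sreach_trans sreach_sym)
  then show ?thesis using u by simp
qed

lemma strong_component_disjoint:
  "C \<in> strong_components S E \<Longrightarrow> C' \<in> strong_components S E \<Longrightarrow> v \<in> C \<Longrightarrow> v \<in> C' \<Longrightarrow> C = C'"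
  using strong_component_eq[of C S E v] strong_component_eq[of C' S E v] by simp

lemma strong_component_nonempty: "C \<in> strong_components S E \<Longrightarrow> C \<noteq> {}"
  unfolding strong_components_def by (auto simp: sreach_refl)

lemma strong_component_subset: "C \<in> strong_components S E \<Longrightarrow> C \<subseteq> S"
  unfolding strong_components_def by auto

lemma strong_componentI: "v \<in> S \<Longrightarrow> {w \<in> S. sreach E S v w} \<in> strong_components S E"
  unfolding strong_components_def by auto

lemma strong_component_mono:
  assumes "C \<in> strong_components S E" and "S \<subseteq> T"
  obtains C' where "C' \<in> strong_components T E" "C \<subseteq> C'"
proof -
  obtain u where u: "u \<in> S" "C = {w \<in> S. sreach E S u w}"
    using assms(1) unfolding strong_components_def by auto
  show ?thesis
  proof (rule that)
    show "{w \<in> T. sreach E T u w} \<in> strong_components T E"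
      using u(1) assms(2) by (intro strong_componentI) blast
    show "C \<subseteq> {w \<in> T. sreach E T u w}"
      using u(2) assms(2) sreach_mono[OF assms(2)] by blast
  qed
qed

text \<open>A walk from u to v inside S can be continued back to u, so each of its vertices is
  mutually reachable with u and the walk stays in the component. This later keeps the inserted walks
  inside their class.\<close>

lemma sreach_inside:
  assumes "u \<in> S" and "sreach E S u v"
  shows "(u, v) \<in> (E \<inter> {w \<in> S. sreach E S u w} \<times> {w \<in> S. sreach E S u w})\<^sup>*"
proof -
  let ?R = "E \<inter> S \<times> S" and ?C = "{w \<in> S. sreach E S u w}"
  have "(u, v) \<in> ?R\<^sup>*" using assms(2) by (simp add: sreach_def)
  \<comment> \<open>The way back to u is carried as a premise because it passes from the last vertex
    z to its predecessor y.\<close>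
  then have "(v, u) \<in> ?R\<^sup>* \<longrightarrow> (u, v) \<in> (E \<inter> ?C \<times> ?C)\<^sup>*"
  proof (induction rule: rtrancl_induct)
    case base
    show ?case by simp
  next
    case (step y z)
    show ?case
    proof
      assume z: "(z, u) \<in> ?R\<^sup>*"
      have y: "(y, u) \<in> ?R\<^sup>*" using step.hyps(2) z by (meson converse_rtrancl_into_rtrancl)
      have "(u, z) \<in> ?R\<^sup>*" using step.hyps by (meson rtrancl.rtrancl_into_rtrancl)
      then have "(y, z) \<in> E \<inter> ?C \<times> ?C" using step.hyps y z by (auto simp: sreach_def)
      then show "(u, z) \<in> (E \<inter> ?C \<times> ?C)\<^sup>*"
        using step.IH y by (meson rtrancl.rtrancl_into_rtrancl)
    qed
  qed
  then show ?thesis using assms(2) by (simp add: sreach_def)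
qed

section \<open>Tails of rays and the components in which ends live\<close>

lemma tail_in_mono: "tail_in r C \<Longrightarrow> C \<subseteq> C' \<Longrightarrow> tail_in r C'"
  unfolding tail_in_def by blast

lemma tail_in_meet:
  assumes "tail_in r C" "tail_in r C'"
  obtains v where "v \<in> C" "v \<in> C'"
proof -
  obtain k k' where "\<forall>n\<ge>k. r n \<in> C" "\<forall>n\<ge>k'. r n \<in> C'"
    using assms unfolding tail_in_def by blast
  then have "r (max k k') \<in> C" "r (max k k') \<in> C'" by auto
  then show ?thesis by (rule that)
qed

lemma tail_in_strong_component_unique:
  "C \<in> strong_components S E \<Longrightarrow> C' \<in> strong_components S E \<Longrightarrow> tail_in r C \<Longrightarrow> tail_in r C' \<Longrightarrow> C = C'"
  by (meson strong_component_disjoint tail_in_meet)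

lemma equiv_rays_sym: "equiv_rays V E r s \<Longrightarrow> equiv_rays V E s r"
  unfolding equiv_rays_def by blast

lemma equiv_rays_trans:
  assumes "equiv_rays V E r s" "equiv_rays V E s t"
  shows "equiv_rays V E r t"
  unfolding equiv_rays_def
proof (intro conjI allI impI)
  show "solid_ray V E r" "solid_ray V E t" using assms by (auto simp: equiv_rays_def)
  fix X assume "finite X \<and> X \<subseteq> V"
  then obtain C C' where C: "C \<in> strong_components (V - X) E" "tail_in r C" "tail_in s C"
      and C': "C' \<in> strong_components (V - X) E" "tail_in s C'" "tail_in t C'"
    using assms unfolding equiv_rays_def by blast
  have "C = C'" using C(1) C'(1) C(3) C'(2) by (rule tail_in_strong_component_unique)
  then show "\<exists>C\<in>strong_components (V - X) E. tail_in r C \<and> tail_in t C"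
    using C C' by auto
qed

lemma equiv_rays_refl: "solid_ray V E r \<Longrightarrow> equiv_rays V E r r"
  unfolding equiv_rays_def solid_ray_def by auto

lemma end_rays_equiv: "\<omega> \<in> ends V E \<Longrightarrow> r \<in> \<omega> \<Longrightarrow> s \<in> \<omega> \<Longrightarrow> equiv_rays V E r s"
  unfolding ends_def by (auto dest!: equiv_rays_sym[of _ _ _ r] intro: equiv_rays_trans)

text \<open>One ray decides the component: any other ray of \<omega> shares a component of D - X
  with r, and a ray has tails in at most one component.\<close>

lemma comp_of_eqI:
  assumes "\<omega> \<in> ends V E" "finite X" "X \<subseteq> V" "r \<in> \<omega>"
    "C \<in> strong_components (V - X) E" "tail_in r C"
  shows "comp_of V E X \<omega> = C"
  unfolding comp_of_def
proof (rule the_equality)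
  show "C \<in> strong_components (V - X) E \<and> (\<exists>r\<in>\<omega>. tail_in r C)" using assms by auto
next
  fix C' assume C': "C' \<in> strong_components (V - X) E \<and> (\<exists>r\<in>\<omega>. tail_in r C')"
  then obtain s where s: "s \<in> \<omega>" "tail_in s C'" by auto
  obtain D where "D \<in> strong_components (V - X) E" "tail_in r D" "tail_in s D"
    using end_rays_equiv[OF assms(1,4) s(1)] assms(2,3) unfolding equiv_rays_def by blast
  then show "C' = C" using C' s assms(5,6) tail_in_strong_component_unique by metis
qed

lemma end_ray:
  assumes "\<omega> \<in> ends V E"
  obtains r where "r \<in> \<omega>" "solid_ray V E r"
  using assms unfolding ends_def by (auto intro: equiv_rays_refl)

lemma comp_of_props:
  assumes "\<omega> \<in> ends V E" "finite X" "X \<subseteq> V"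
  shows comp_of_strong_component: "comp_of V E X \<omega> \<in> strong_components (V - X) E"
    and tail_in_comp_of: "r \<in> \<omega> \<Longrightarrow> tail_in r (comp_of V E X \<omega>)"
proof -
  have *: "\<exists>C\<in>strong_components (V - X) E. tail_in s C" if "s \<in> \<omega>" for s
    using end_rays_equiv[OF assms(1) that that] assms(2,3) unfolding equiv_rays_def by blast
  then show "tail_in r (comp_of V E X \<omega>)" if "r \<in> \<omega>"
    using comp_of_eqI[OF assms that] that by auto
  obtain s where "s \<in> \<omega>" using end_ray assms(1) by blast
  with * show "comp_of V E X \<omega> \<in> strong_components (V - X) E"
    using comp_of_eqI[OF assms] by metis
qed

lemma comp_of_antimono:
  assumes "\<omega> \<in> ends V E" "finite X" "X \<subseteq> V" "Y \<subseteq> X"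
  shows "comp_of V E X \<omega> \<subseteq> comp_of V E Y \<omega>"
proof -
  obtain C' where C': "C' \<in> strong_components (V - Y) E" "comp_of V E X \<omega> \<subseteq> C'"
    using strong_component_mono[OF comp_of_strong_component[OF assms(1-3)], of "V - Y"] assms(4)
    by auto
  obtain r where r: "r \<in> \<omega>" using end_ray assms(1) by blast
  have "comp_of V E Y \<omega> = C'"
  proof (rule comp_of_eqI[OF assms(1) _ _ r C'(1)])
    show "tail_in r C'" using tail_in_comp_of[OF assms(1-3) r] C'(2) by (rule tail_in_mono)
  qed (use assms finite_subset in auto)
  then show ?thesis using C' by simp
qed

text \<open>If no finite X told the ends apart, representative rays would have tails in a common
  component of every D - X and so be equivalent. The lemma supplies the separators for
  neighbourhoods of limit edges between two ends.\<close>

lemma ends_separated: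
  assumes "\<omega> \<in> ends V E" "\<eta> \<in> ends V E" "\<omega> \<noteq> \<eta>"
  obtains X where "finite X" "X \<subseteq> V" "comp_of V E X \<omega> \<noteq> comp_of V E X \<eta>"
proof (rule ccontr)
  assume "\<not> thesis"
  then have eq: "comp_of V E X \<omega> = comp_of V E X \<eta>" if "finite X" "X \<subseteq> V" for X
    using that \<open>\<And>X. \<lbrakk>finite X; X \<subseteq> V; comp_of V E X \<omega> \<noteq> comp_of V E X \<eta>\<rbrakk> \<Longrightarrow> thesis\<close> by blast
  obtain r where r: "solid_ray V E r" "\<omega> = {s. equiv_rays V E r s}"
    using assms(1) unfolding ends_def by blast
  obtain r' where r': "solid_ray V E r'" "\<eta> = {s. equiv_rays V E r' s}"
    using assms(2) unfolding ends_def by blast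
  have in_r: "r \<in> \<omega>" "r' \<in> \<eta>" using r r' equiv_rays_refl by auto
  have "equiv_rays V E r r'"
    unfolding equiv_rays_def
  proof (intro conjI allI impI r(1) r'(1))
    fix X assume X: "finite X \<and> X \<subseteq> V"
    have "tail_in r (comp_of V E X \<omega>)" using tail_in_comp_of assms in_r X by blast
    moreover have "tail_in r' (comp_of V E X \<omega>)" using tail_in_comp_of[OF assms(2)] in_r X eq by metis
    moreover have "comp_of V E X \<omega> \<in> strong_components (V - X) E" 
      using comp_of_strong_component assms X by blast
    ultimately show "\<exists>C\<in>strong_components (V - X) E. tail_in r C \<and> tail_in r' C" by blast
  qed
  then have "\<omega> = \<eta>" unfolding r(2) r'(2) using equiv_rays_sym equiv_rays_trans by blast
  with assms(3) show False by simp
qed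

lemma liv_iff:
  "Vx v \<in> liv V E X \<omega> \<longleftrightarrow> v \<in> comp_of V E X \<omega>"
  "En \<eta> \<in> liv V E X \<omega> \<longleftrightarrow> \<eta> \<in> ends V E \<and> comp_of V E X \<eta> = comp_of V E X \<omega>"
  by (auto simp: liv_def lives_in_def)

section \<open>Directed topological paths cannot leave an out-closed vertex set\<close>

text \<open>For an end the component is taken with X = {}. When A is closed under out-neighbours, a
  strong component of D that meets A lies in A, so the inclusion can be tested at any one vertex of
  the component.\<close>

definition side :: "'v set \<Rightarrow> ('v \<times> 'v) set \<Rightarrow> 'v set \<Rightarrow> 'v vend \<Rightarrow> real" where
  "side V E A y = (case y of Vx v \<Rightarrow> of_bool (v \<in> A) | En \<omega> \<Rightarrow> of_bool (comp_of V E {} \<omega> \<subseteq> A))"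

fun cut_potential :: "'v set \<Rightarrow> ('v \<times> 'v) set \<Rightarrow> 'v set \<Rightarrow> 'v point \<Rightarrow> real" where
  "cut_potential V E A (Pt y) = side V E A y"
| "cut_potential V E A (Inner a b t) = (1 - t) * side V E A a + t * side V E A b"

lemma side_values: "side V E A y = 0 \<or> side V E A y = 1"
  by (auto simp: side_def split: vend.splits)

lemma strong_component_closed:
  assumes "C \<in> strong_components S E" "E `` A \<subseteq> A" "v \<in> C" "v \<in> A"
  shows "C \<subseteq> A"
proof
  fix w assume "w \<in> C"
  then have "w \<in> {w \<in> S. sreach E S v w}" using strong_component_eq[OF assms(1,3)] by simp
  then have "sreach E S v w" by simp
  then have "(v, w) \<in> (E \<inter> S \<times> S)\<^sup>*" by (simp add: sreach_def)
  then have "(v, w) \<in> E\<^sup>*" using rtrancl_mono[OF Int_lower1] by blast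
  then show "w \<in> A" using assms(2,4) Image_closed_trancl[of E A] by blast
qed

lemma side_comp_vertex:
  assumes "E `` A \<subseteq> A" "\<omega> \<in> ends V E" "v \<in> comp_of V E {} \<omega>"
  shows "side V E A (En \<omega>) = of_bool (v \<in> A)"
  using strong_component_closed[OF comp_of_strong_component assms(1) assms(3)] assms(2,3)
  by (auto simp: side_def)

text \<open>Deleting X only splits components: whatever lives in
  \<open>comp_of V E X \<omega>\<close> also lives in the component of \<omega> in D itself, and
  that one is on a single side.\<close>

lemma side_liv:
  assumes "E `` A \<subseteq> A" "\<omega> \<in> ends V E" "finite X" "X \<subseteq> V" "y \<in> liv V E X \<omega>"
  shows "side V E A y = side V E A (En \<omega>)"
proof (cases y)
  case (Vx v)
  then have "v \<in> comp_of V E {} \<omega>"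
    using assms(5) comp_of_antimono[OF assms(2-4), of "{}"] by (auto simp: liv_iff)
  then show ?thesis using side_comp_vertex[OF assms(1,2)] Vx by (simp add: side_def)
next
  case (En \<eta>)
  then have \<eta>: "\<eta> \<in> ends V E" "comp_of V E X \<eta> = comp_of V E X \<omega>" using assms(5) by (auto simp: liv_iff)
  obtain v where v: "v \<in> comp_of V E X \<omega>"
    using strong_component_nonempty[OF comp_of_strong_component[OF assms(2-4)]] by auto
  then have "v \<in> comp_of V E {} \<omega>" "v \<in> comp_of V E {} \<eta>"
    using comp_of_antimono[OF assms(2-4), of "{}"] comp_of_antimono[OF \<eta>(1) assms(3,4), of "{}"] \<eta>(2) by auto
  then show ?thesis using side_comp_vertex[OF assms(1)] assms(2) \<eta>(1) En by metis
qed

lemma all_edges_cases: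
  assumes "(a, b) \<in> all_edges V E"
  obtains (D) u w where "a = Vx u" "b = Vx w" "(u, w) \<in> E"
    | (EE) \<omega> \<eta> where "a = En \<omega>" "b = En \<eta>" "(a, b) \<in> limit_edges V E"
        "\<omega> \<in> ends V E" "\<eta> \<in> ends V E" "\<omega> \<noteq> \<eta>"
        "\<And>X. finite X \<Longrightarrow> X \<subseteq> V \<Longrightarrow> comp_of V E X \<omega> \<noteq> comp_of V E X \<eta> \<Longrightarrow>
          \<exists>u\<in>comp_of V E X \<omega>. \<exists>w\<in>comp_of V E X \<eta>. (u, w) \<in> E"
    | (VE) v \<omega> where "a = Vx v" "b = En \<omega>" "(a, b) \<in> limit_edges V E" "\<omega> \<in> ends V E" "v \<in> V"
        "\<And>X. finite X \<Longrightarrow> X \<subseteq> V \<Longrightarrow> v \<notin> comp_of V E X \<omega> \<Longrightarrow> \<exists>w\<in>comp_of V E X \<omega>. (v, w) \<in> E"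
    | (EV) \<omega> v where "a = En \<omega>" "b = Vx v" "(a, b) \<in> limit_edges V E" "\<omega> \<in> ends V E" "v \<in> V"
        "\<And>X. finite X \<Longrightarrow> X \<subseteq> V \<Longrightarrow> v \<notin> comp_of V E X \<omega> \<Longrightarrow> \<exists>w\<in>comp_of V E X \<omega>. (w, v) \<in> E"
proof (cases "(a, b) \<in> limit_edges V E")
  case False
  then show ?thesis using assms D unfolding all_edges_def by auto
next
  case True
  note lim = this
  show ?thesis
    using True unfolding limit_edges_def
  proof (elim UnE CollectE exE conjE)
    fix \<omega> \<eta> assume "(a, b) = (En \<omega>, En \<eta>)" and "\<omega> \<in> ends V E" "\<eta> \<in> ends V E" "\<omega> \<noteq> \<eta>"
      and "\<forall>X. finite X \<and> X \<subseteq> V \<and> comp_of V E X \<omega> \<noteq> comp_of V E X \<eta> \<longrightarrow>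
           (\<exists>u\<in>comp_of V E X \<omega>. \<exists>w\<in>comp_of V E X \<eta>. (u, w) \<in> E)"
    then show ?thesis by (intro EE[OF _ _ lim]) auto
  next
    fix v \<omega> assume "(a, b) = (Vx v, En \<omega>)" and "v \<in> V" "\<omega> \<in> ends V E"
      and "\<forall>X. finite X \<and> X \<subseteq> V \<and> v \<notin> comp_of V E X \<omega> \<longrightarrow> (\<exists>w\<in>comp_of V E X \<omega>. (v, w) \<in> E)"
    then show ?thesis by (intro VE[OF _ _ lim]) auto
  next
    fix v \<omega> assume "(a, b) = (En \<omega>, Vx v)" and "v \<in> V" "\<omega> \<in> ends V E"
      and "\<forall>X. finite X \<and> X \<subseteq> V \<and> v \<notin> comp_of V E X \<omega> \<longrightarrow> (\<exists>w\<in>comp_of V E X \<omega>. (w, v) \<in> E)"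
    then show ?thesis by (intro EV[OF _ _ lim]) auto
  qed
qed

text \<open>The defining condition of a limit edge is used with X = {}: either both endpoints belong
  to the same strong component of D, or an edge of D joins their components, and no edge of D leaves
  A.\<close>

lemma side_edge_mono:
  assumes A: "E `` A \<subseteq> A" and e: "(a, b) \<in> all_edges V E"
  shows "side V E A a \<le> side V E A b"
proof -
  show ?thesis
    using e
  proof (cases rule: all_edges_cases)
    case D
    then show ?thesis using A by (auto simp: side_def)
  next
    case (EE \<omega> \<eta>)
    show ?thesis
    proof (cases "comp_of V E {} \<omega> = comp_of V E {} \<eta>")
      case True
      then show ?thesis using EE by (simp add: side_def)
    next
      case False
      then obtain u w where uw: "u \<in> comp_of V E {} \<omega>" "w \<in> comp_of V E {} \<eta>" "(u, w) \<in> E"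
        using EE(7)[of "{}"] by auto
      have "side V E A a = of_bool (u \<in> A)" "side V E A b = of_bool (w \<in> A)"
        using side_comp_vertex[OF A] EE(1-5) uw by simp_all
      then show ?thesis using uw(3) A by auto
    qed
  next
    case (VE v \<omega>)
    show ?thesis
    proof (cases "v \<in> comp_of V E {} \<omega>")
      case True
      then show ?thesis using side_comp_vertex[OF A VE(4)] VE by (simp add: side_def)
    next
      case False
      then obtain w where w: "w \<in> comp_of V E {} \<omega>" "(v, w) \<in> E" using VE(6)[of "{}"] by auto
      have "side V E A b = of_bool (w \<in> A)" using side_comp_vertex[OF A VE(4) w(1)] VE by simp
      then show ?thesis using w(2) A VE(1) by (auto simp: side_def)
    qed
  next
    case (EV \<omega> v)
    show ?thesis
    proof (cases "v \<in> comp_of V E {} \<omega>")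
      case True
      then show ?thesis using side_comp_vertex[OF A EV(4)] EV by (simp add: side_def)
    next
      case False
      then obtain w where w: "w \<in> comp_of V E {} \<omega>" "(w, v) \<in> E" using EV(6)[of "{}"] by auto
      have "side V E A a = of_bool (w \<in> A)" using side_comp_vertex[OF A EV(4) w(1)] EV by simp
      then show ?thesis using w(2) A EV(2) by (auto simp: side_def)
    qed
  qed
qed

section \<open>Generators of the topology and the points they contain\<close>

lemma topspace_DTop: "topspace (DTop V E) = \<Union>(gen_sets V E)"
  by (simp add: DTop_def)

lemma openin_DTop: "U \<in> gen_sets V E \<Longrightarrow> openin (DTop V E) U"
  unfolding DTop_def by (rule topology_generated_by_Basis)

lemma star_set_generator: "v \<in> V \<Longrightarrow> 0 < \<epsilon> \<Longrightarrow> star_set V E v \<epsilon> \<in> gen_sets V E"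
  unfolding gen_sets_def by (intro UnI1 CollectI exI[of _ v] exI[of _ \<epsilon>] conjI refl)

lemma edge_generator:
  "(u, w) \<in> E \<Longrightarrow> 0 \<le> p \<Longrightarrow> p < q \<Longrightarrow> q \<le> 1 \<Longrightarrow>
    {Inner (Vx u) (Vx w) t | t. p < t \<and> t < q} \<in> gen_sets V E"
  unfolding gen_sets_def by (rule UnI1, rule UnI1, rule UnI1, rule UnI1, rule UnI2) blast

lemma end_nbhd_generator:
  "\<omega> \<in> ends V E \<Longrightarrow> finite X \<Longrightarrow> X \<subseteq> V \<Longrightarrow> 0 < \<epsilon> \<Longrightarrow> end_nbhd V E X \<omega> \<epsilon> \<in> gen_sets V E"
  unfolding gen_sets_def by (rule UnI1, rule UnI1, rule UnI1, rule UnI2) blast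

lemma lim_nbhd_generators:
  fixes t \<epsilon> :: real
  assumes "finite X" "X \<subseteq> V" "0 < t" "t < 1" "0 < \<epsilon>"
  shows "(En \<omega>, En \<eta>) \<in> limit_edges V E \<Longrightarrow> comp_of V E X \<omega> \<noteq> comp_of V E X \<eta> \<Longrightarrow>
      lim_nbhd V E (liv V E X \<omega>) (liv V E X \<eta>) t \<epsilon> \<in> gen_sets V E"
    and "(Vx v, En \<omega>) \<in> limit_edges V E \<Longrightarrow> v \<in> X \<Longrightarrow>
      lim_nbhd V E {Vx v} (liv V E X \<omega>) t \<epsilon> \<in> gen_sets V E"
    and "(En \<omega>, Vx v) \<in> limit_edges V E \<Longrightarrow> v \<in> X \<Longrightarrow>
      lim_nbhd V E (liv V E X \<omega>) {Vx v} t \<epsilon> \<in> gen_sets V E"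
proof -
  show "(En \<omega>, En \<eta>) \<in> limit_edges V E \<Longrightarrow> comp_of V E X \<omega> \<noteq> comp_of V E X \<eta> \<Longrightarrow>
      lim_nbhd V E (liv V E X \<omega>) (liv V E X \<eta>) t \<epsilon> \<in> gen_sets V E"
    unfolding gen_sets_def by (rule UnI1, rule UnI1, rule UnI2) (use assms in blast)
  show "(Vx v, En \<omega>) \<in> limit_edges V E \<Longrightarrow> v \<in> X \<Longrightarrow>
      lim_nbhd V E {Vx v} (liv V E X \<omega>) t \<epsilon> \<in> gen_sets V E"
    unfolding gen_sets_def by (rule UnI1, rule UnI2) (use assms in blast)
  show "(En \<omega>, Vx v) \<in> limit_edges V E \<Longrightarrow> v \<in> X \<Longrightarrow>
      lim_nbhd V E (liv V E X \<omega>) {Vx v} t \<epsilon> \<in> gen_sets V E"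
    unfolding gen_sets_def by (rule UnI2) (use assms in blast)
qed

text \<open>The three families around limit edges are merged into \<open>lim\<close>, with arbitrary
  A and B: the later case analyses use only that such a set consists of inner points of edges with
  parameter close to t.\<close>

lemma gen_sets_cases:
  assumes "U \<in> gen_sets V E"
  obtains (star) v \<epsilon> where "U = star_set V E v \<epsilon>" "v \<in> V" "0 < \<epsilon>"
    | (edge) u w p q where "U = {Inner (Vx u) (Vx w) t | t. p < t \<and> t < q}" "(u, w) \<in> E" "0 \<le> p" "p < q" "q \<le> 1"
    | (comp) X \<omega> \<epsilon> where "U = end_nbhd V E X \<omega> \<epsilon>" "\<omega> \<in> ends V E" "finite X" "X \<subseteq> V" "0 < \<epsilon>"
    | (lim) A B t \<epsilon> where "U = lim_nbhd V E A B t \<epsilon>"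
  using assms unfolding gen_sets_def
  by (elim UnE CollectE exE conjE) (rule star edge comp lim; assumption)+

lemma inner_in_topspace:
  assumes "Inner a b t \<in> topspace (DTop V E)"
  shows "(a, b) \<in> all_edges V E \<and> 0 < t \<and> t < 1"
proof -
  obtain U where U: "U \<in> gen_sets V E" "Inner a b t \<in> U"
    using assms unfolding topspace_DTop by blast
  from U(1) show ?thesis
  proof (cases rule: gen_sets_cases)
    case star
    then show ?thesis using U(2) by (simp add: star_set_def)
  next
    case edge
    then show ?thesis using U(2) by (auto simp: all_edges_def)
  next
    case comp
    then show ?thesis using U(2) by (simp add: end_nbhd_def Let_def)
  next
    case lim
    then show ?thesis using U(2) by (simp add: lim_nbhd_def)
  qed
qed

lemma vend_in_topspace:
  assumes "Pt y \<in> topspace (DTop V E)"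
  shows "case y of Vx v \<Rightarrow> v \<in> V | En \<omega> \<Rightarrow> \<omega> \<in> ends V E"
proof -
  obtain U where U: "U \<in> gen_sets V E" "Pt y \<in> U"
    using assms unfolding topspace_DTop by blast
  from U(1) show ?thesis
  proof (cases rule: gen_sets_cases)
    case star
    then show ?thesis using U(2) by (simp add: star_set_def)
  next
    case edge
    then show ?thesis using U(2) by auto
  next
    case (comp X \<omega>)
    have "lives_in V E X y (comp_of V E X \<omega>)"
      using U(2) unfolding comp(1) by (simp add: end_nbhd_def Let_def)
    moreover have "comp_of V E X \<omega> \<subseteq> V"
      using strong_component_subset[OF comp_of_strong_component[OF comp(2-4)]] by blast
    ultimately show ?thesis by (auto simp: lives_in_def split: vend.splits)
  next
    case lim
    then show ?thesis using U(2) by (simp add: lim_nbhd_def)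
  qed
qed

text \<open>Unifies the four types of edges for the continuity proof. It works because
  \<open>side\<close> is constant on the vertices and ends living in one component.\<close>

lemma inner_generator:
  assumes A: "E `` A \<subseteq> A" and e: "(a, b) \<in> all_edges V E" and t: "0 < t" "t < 1" and \<epsilon>: "0 < \<epsilon>"
  obtains U where "U \<in> gen_sets V E" "Inner a b t \<in> U"
    "\<And>z. z \<in> U \<Longrightarrow> \<exists>a' b' s. z = Inner a' b' s \<and> side V E A a' = side V E A a
        \<and> side V E A b' = side V E A b \<and> \<bar>s - t\<bar> < \<epsilon>"
proof -
  show ?thesis
    using e
  proof (cases rule: all_edges_cases)
    case (D u w)
    let ?U = "{Inner (Vx u) (Vx w) s | s. max 0 (t - \<epsilon>) < s \<and> s < min 1 (t + \<epsilon>)}"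
    show ?thesis
    proof (rule that)
      show "?U \<in> gen_sets V E"
        using D(3) t \<epsilon> by (intro edge_generator) auto
    qed (use D t \<epsilon> in auto)
  next
    case (EE \<omega> \<eta>)
    obtain X where X: "finite X" "X \<subseteq> V" "comp_of V E X \<omega> \<noteq> comp_of V E X \<eta>"
      using ends_separated[OF EE(4-6)] by blast
    let ?U = "lim_nbhd V E (liv V E X \<omega>) (liv V E X \<eta>) t \<epsilon>"
    show ?thesis
    proof (rule that)
      show "?U \<in> gen_sets V E"
        using EE X t \<epsilon> by (intro lim_nbhd_generators) auto
      show "Inner a b t \<in> ?U" using e EE t \<epsilon> by (auto simp: lim_nbhd_def liv_iff)
      show "\<exists>a' b' s. z = Inner a' b' s \<and> side V E A a' = side V E A a
        \<and> side V E A b' = side V E A b \<and> \<bar>s - t\<bar> < \<epsilon>" if "z \<in> ?U" for z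
        using that side_liv[OF A EE(4) X(1,2)] side_liv[OF A EE(5) X(1,2)] EE(1,2)
        by (auto simp: lim_nbhd_def)
    qed
  next
    case (VE v \<omega>)
    \<comment> \<open>This family of generators demands v \<in> X; the set X = {v} is the smallest
      choice.\<close>
    let ?U = "lim_nbhd V E {Vx v} (liv V E {v} \<omega>) t \<epsilon>"
    show ?thesis
    proof (rule that)
      show "?U \<in> gen_sets V E"
        using VE t \<epsilon> by (intro lim_nbhd_generators) auto
      show "Inner a b t \<in> ?U" using e VE t \<epsilon> by (auto simp: lim_nbhd_def liv_iff)
      show "\<exists>a' b' s. z = Inner a' b' s \<and> side V E A a' = side V E A a
        \<and> side V E A b' = side V E A b \<and> \<bar>s - t\<bar> < \<epsilon>" if "z \<in> ?U" for z
        using that side_liv[OF A VE(4), of "{v}"] VE(1,2,5) by (auto simp: lim_nbhd_def)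
    qed
  next
    case (EV \<omega> v)
    let ?U = "lim_nbhd V E (liv V E {v} \<omega>) {Vx v} t \<epsilon>"
    show ?thesis
    proof (rule that)
      show "?U \<in> gen_sets V E"
        using EV t \<epsilon> by (intro lim_nbhd_generators) auto
      show "Inner a b t \<in> ?U" using e EV t \<epsilon> by (auto simp: lim_nbhd_def liv_iff)
      show "\<exists>a' b' s. z = Inner a' b' s \<and> side V E A a' = side V E A a
        \<and> side V E A b' = side V E A b \<and> \<bar>s - t\<bar> < \<epsilon>" if "z \<in> ?U" for z
        using that side_liv[OF A EV(4), of "{v}"] EV(1,2,5) by (auto simp: lim_nbhd_def)
    qed
  qed
qed

section \<open>Continuity and monotonicity of the cut potential\<close>

lemma cut_potential_near:
  fixes t \<epsilon> :: real
  assumes "0 < t" "t < 1"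
  shows "t < \<epsilon> \<Longrightarrow> \<bar>cut_potential V E A (Inner a b t) - side V E A a\<bar> < \<epsilon>"
    and "1 - \<epsilon> < t \<Longrightarrow> \<bar>cut_potential V E A (Inner a b t) - side V E A b\<bar> < \<epsilon>"
  using assms side_values[of V E A a] side_values[of V E A b] by auto

lemma continuous_cut_potential:
  assumes A: "E `` A \<subseteq> A"
  shows "continuous_map (DTop V E) euclideanreal (cut_potential V E A)"
proof -
  let ?\<phi> = "cut_potential V E A"
  have key: "\<exists>U. openin (DTop V E) U \<and> z \<in> U \<and> (\<forall>z'\<in>U. \<bar>?\<phi> z' - ?\<phi> z\<bar> < \<epsilon>)"
    if z: "z \<in> topspace (DTop V E)" and \<epsilon>: "0 < \<epsilon>" for z \<epsilon>
  proof (cases z)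
    case (Inner a b t)
    then have ab: "(a, b) \<in> all_edges V E" "0 < t" "t < 1" using z inner_in_topspace by metis+
    obtain U where U: "U \<in> gen_sets V E" "Inner a b t \<in> U"
      and *: "\<And>z. z \<in> U \<Longrightarrow> \<exists>a' b' s. z = Inner a' b' s \<and> side V E A a' = side V E A a
        \<and> side V E A b' = side V E A b \<and> \<bar>s - t\<bar> < \<epsilon>"
      using inner_generator[OF A ab \<epsilon>] by metis
    have "\<bar>?\<phi> z' - ?\<phi> z\<bar> < \<epsilon>" if z': "z' \<in> U" for z'
    proof -
      obtain a' b' s where s: "z' = Inner a' b' s" "side V E A a' = side V E A a"
        "side V E A b' = side V E A b" "\<bar>s - t\<bar> < \<epsilon>" using *[OF z'] by auto
      \<comment> \<open>The two potentials differ only through the parameter, with slope -1, 0 or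
        1.\<close>
      have "?\<phi> z' - ?\<phi> z = (s - t) * (side V E A b - side V E A a)"
        by (simp add: s Inner algebra_simps)
      then show ?thesis
        using s(4) \<epsilon> side_values[of V E A a] side_values[of V E A b] by auto
    qed
    then show ?thesis using U openin_DTop Inner by blast
  next
    case (Pt y)
    show ?thesis
    proof (cases y)
      case (Vx v)
      then have v: "v \<in> V" using vend_in_topspace z Pt by fastforce
      have "star_set V E v \<epsilon> \<in> gen_sets V E" using v \<epsilon> by (rule star_set_generator)
      moreover have "z \<in> star_set V E v \<epsilon>" by (simp add: star_set_def Pt Vx)
      moreover have "\<bar>?\<phi> z' - ?\<phi> z\<bar> < \<epsilon>" if z': "z' \<in> star_set V E v \<epsilon>" for z'
      proof (cases z')
        case (Inner a b t)
        have "0 < t" "t < 1" "(a = Vx v \<and> t < \<epsilon>) \<or> (b = Vx v \<and> 1 - \<epsilon> < t)"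
          using z' Inner by (auto simp: star_set_def)
        then show ?thesis using cut_potential_near Inner Pt Vx by (metis cut_potential.simps(1))
      qed (use z' \<epsilon> Pt Vx in \<open>auto simp: star_set_def\<close>)
      ultimately show ?thesis using openin_DTop by blast
    next
      case (En \<omega>)
      then have \<omega>: "\<omega> \<in> ends V E" using vend_in_topspace z Pt by fastforce
      \<comment> \<open>X = {} is already fine enough: everything living in one strong component of
        D has the same side.\<close>
      have "end_nbhd V E {} \<omega> \<epsilon> \<in> gen_sets V E" using \<omega> \<epsilon> by (simp add: end_nbhd_generator)
      moreover have "z \<in> end_nbhd V E {} \<omega> \<epsilon>" using \<omega> by (simp add: end_nbhd_def Pt En Let_def lives_in_def)
      moreover have "\<bar>?\<phi> z' - ?\<phi> z\<bar> < \<epsilon>" if z': "z' \<in> end_nbhd V E {} \<omega> \<epsilon>" for z'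
      proof (cases z')
        case (Pt y')
        then have "y' \<in> liv V E {} \<omega>" using z' by (auto simp: end_nbhd_def Let_def liv_def)
        then show ?thesis using side_liv[OF A \<omega>, of "{}"] Pt En \<open>z = Pt y\<close> \<epsilon> by auto
      next
        case (Inner a b t)
        have t: "0 < t" "t < 1" and
          "(a \<in> liv V E {} \<omega> \<and> b \<in> liv V E {} \<omega>) \<or> (a \<in> liv V E {} \<omega> \<and> t < \<epsilon>) \<or> (b \<in> liv V E {} \<omega> \<and> 1 - \<epsilon> < t)"
          using z' Inner by (auto simp: end_nbhd_def Let_def liv_def)
        then consider "side V E A a = side V E A y" "side V E A b = side V E A y"
          | "side V E A a = side V E A y" "t < \<epsilon>" | "side V E A b = side V E A y" "1 - \<epsilon> < t"
          using side_liv[OF A \<omega>, of "{}"] En by auto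
        then show ?thesis
        proof cases
          case 1
          then show ?thesis using \<open>z = Pt y\<close> Inner \<epsilon> by (simp add: algebra_simps)
        qed (use cut_potential_near[OF t] Inner \<open>z = Pt y\<close> in \<open>metis cut_potential.simps(1)\<close>)+
      qed
      ultimately show ?thesis using openin_DTop by blast
    qed
  qed
  show ?thesis
    unfolding continuous_map_def
  proof (intro conjI allI impI)
    fix W :: "real set" assume "openin euclideanreal W"
    then have W: "open W" by simp
    show "openin (DTop V E) {z \<in> topspace (DTop V E). ?\<phi> z \<in> W}"
    proof (subst openin_subopen, intro ballI)
      fix z assume z: "z \<in> {z \<in> topspace (DTop V E). ?\<phi> z \<in> W}"
      then obtain \<epsilon> where \<epsilon>: "0 < \<epsilon>" "\<And>r. \<bar>r - ?\<phi> z\<bar> < \<epsilon> \<Longrightarrow> r \<in> W"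
        using W unfolding open_dist dist_real_def by blast
      obtain U where "openin (DTop V E) U" "z \<in> U" "\<forall>z'\<in>U. \<bar>?\<phi> z' - ?\<phi> z\<bar> < \<epsilon>"
        using key z \<epsilon>(1) by blast
      then show "\<exists>T. openin (DTop V E) T \<and> z \<in> T \<and> T \<subseteq> {z \<in> topspace (DTop V E). ?\<phi> z \<in> W}"
        using \<epsilon>(2) openin_subset by blast
    qed
  qed auto
qed

text \<open>If the potential dropped between s and s', some value y in (0,1) would be attained at a
  last time x. Such a value occurs only inside an edge that crosses from side 0 to side 1, and there
  order preservation keeps the potential from falling just after x.\<close>

lemma cut_potential_mono:
  assumes A: "E `` A \<subseteq> A" and \<alpha>: "dtop_path V E \<alpha>" and ss: "0 \<le> s" "s \<le> s'" "s' \<le> 1"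
  shows "cut_potential V E A (\<alpha> s) \<le> cut_potential V E A (\<alpha> s')"
proof (rule ccontr)
  define g where "g = cut_potential V E A \<circ> \<alpha>"
  have \<alpha>c: "continuous_map (top_of_set {0..1}) (DTop V E) \<alpha>" using \<alpha> by (simp add: dtop_path_def)
  have top: "\<alpha> x \<in> topspace (DTop V E)" if "x \<in> {0..1}" for x
    using continuous_map_image_subset_topspace[OF \<alpha>c] that by auto
  have gc: "continuous_on {0..1} g"
    using continuous_map_compose[OF \<alpha>c continuous_cut_potential[OF A]] by (simp add: g_def)
  have range: "0 \<le> g x" "g x \<le> 1" if x: "x \<in> {0..1}" for x
  proof -
    have "0 \<le> cut_potential V E A (\<alpha> x) \<and> cut_potential V E A (\<alpha> x) \<le> 1"
    proof (cases "\<alpha> x")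
      case (Pt y)
      then show ?thesis using side_values[of V E A y] by auto
    next
      case (Inner a b t)
      then have "0 < t" "t < 1" using inner_in_topspace top[OF x] by metis+
      then show ?thesis using side_values[of V E A a] side_values[of V E A b] Inner by auto
    qed
    then show "0 \<le> g x" "g x \<le> 1" by (auto simp: g_def)
  qed
  assume "\<not> ?thesis"
  then have lt: "g s' < g s" by (simp add: g_def)
  then obtain y where y: "g s' < y" "y < g s" using dense by blast
  have y01: "0 < y" "y < 1" using y range(1)[of s'] range(2)[of s] ss by auto
  \<comment> \<open>The supremum of T is the last time in [s, s'] at which the potential is still at
    least y.\<close>
  define T where "T = {z \<in> {s..s'}. y \<le> g z}"
  have gc': "continuous_on {s..s'} g" using gc continuous_on_subset ss by (metis atLeastatMost_subset_iff)
  have "closed T"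
    unfolding T_def using continuous_closed_preimage[OF gc', of "{y..}"]
    by (simp add: vimage_def Int_def conj_commute)
  moreover have "T \<noteq> {}" "bdd_above T" using y ss unfolding T_def by auto
  ultimately have "Sup T \<in> T" using closed_contains_Sup by blast
  define x where "x = Sup T"
  have x: "s \<le> x" "x \<le> s'" "y \<le> g x" using \<open>Sup T \<in> T\<close> unfolding x_def T_def by auto
  have after: "g z < y" if "x < z" "z \<le> s'" for z
    using that x cSup_upper[of z T] \<open>bdd_above T\<close> unfolding T_def x_def by force
  have "x < s'" using x y by (metis after less_le not_le order_less_irrefl)
  \<comment> \<open>A value above y at x would force, by the intermediate value theorem, another
    value above y at a later time.\<close>
  have gx: "g x = y"
  proof (rule ccontr)
    assume "g x \<noteq> y"
    then have "y < g x" using x by simp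
    have "continuous_on {x..s'} g" using gc' x by (meson atLeastatMost_subset_iff continuous_on_subset order_refl)
    then obtain z where "x \<le> z" "z \<le> s'" "g z = (y + g x) / 2"
      using IVT2'[of g s' "(y + g x) / 2" x] y \<open>y < g x\<close> x by auto
    then show False using after[of z] \<open>y < g x\<close> by (cases "x = z") auto
  qed
  have x1: "x < 1" using \<open>x < s'\<close> ss by simp
  have x0: "0 < x"
  proof (rule ccontr)
    assume "\<not> 0 < x"
    then have "x = s" using x ss by auto
    then show False using gx y by simp
  qed
  obtain a b t where ab: "\<alpha> x = Inner a b t"
  proof (cases "\<alpha> x")
    case (Pt z)
    then show ?thesis using gx y01 side_values[of V E A z] by (auto simp: g_def)
  qed (use that in blast)
  have e: "(a, b) \<in> all_edges V E" "0 < t" "t < 1"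
    using inner_in_topspace top[of x] ab x0 x1 by (metis atLeastAtMost_iff less_imp_le)+
  \<comment> \<open>Equal sides would give the potential 0 or 1 instead of y, and
    \<open>side_edge_mono\<close> excludes a crossing in the other direction. With these sides the
    potential is just the edge parameter.\<close>
  have sd: "side V E A a = 0 \<and> side V E A b = 1"
    using gx ab y01 side_values[of V E A a] side_values[of V E A b] side_edge_mono[OF A e(1)]
    by (auto simp: g_def)
  obtain c d where cd: "homeo_nbhd V E \<alpha> x a b c d"
    using \<alpha> x0 x1 e ab unfolding dtop_path_def by (metis greaterThanLessThan_iff)
  then obtain f where f: "mono_on {c..d} f" "f ` {c..d} \<subseteq> {0..1}" "\<forall>s\<in>{c..d}. \<alpha> s = edge_param a b (f s)"
    using \<alpha> x0 x1 e ab unfolding dtop_path_def by (metis greaterThanLessThan_iff)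
  have gf: "g z = f z" if "z \<in> {c..d}" for z
    using f(3) that sd by (auto simp: g_def edge_param_def)
  have "x < d" "c < x" using cd by (auto simp: homeo_nbhd_def)
  define z where "z = min d s'"
  have "x < z" "z \<le> s'" "z \<in> {c..d}" "x \<in> {c..d}"
    using \<open>x < d\<close> \<open>c < x\<close> \<open>x < s'\<close> unfolding z_def by auto
  then have "g x \<le> g z" using gf mono_onD[OF f(1)] by (metis less_imp_le)
  then show False using after[OF \<open>x < z\<close> \<open>z \<le> s'\<close>] gx by simp
qed

text \<open>On a closed path a nondecreasing potential is constant, so every vertex is on the same
  side as u of the cut given by the set reachable from u.\<close>

lemma strongly_connected_if_dtop_path:
  assumes "dtop_path V E \<alpha>" "\<alpha> 0 = \<alpha> 1" "\<forall>v\<in>V. Pt (Vx v) \<in> \<alpha> ` {0..1}"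
  shows "strongly_connected V E"
  unfolding strongly_connected_def
proof (intro ballI)
  fix u v assume uv: "u \<in> V" "v \<in> V"
  define A where "A = E\<^sup>* `` {u}"
  have A: "E `` A \<subseteq> A" unfolding A_def by (auto intro: rtrancl_into_rtrancl)
  have const: "cut_potential V E A (\<alpha> x) = cut_potential V E A (\<alpha> 0)" if "x \<in> {0..1}" for x
    using cut_potential_mono[OF A assms(1), of 0 x] cut_potential_mono[OF A assms(1), of x 1] assms(2) that
    by auto
  have pot: "of_bool (w \<in> A) = cut_potential V E A (\<alpha> 0)" if "w \<in> V" for w
  proof -
    have "Pt (Vx w) \<in> \<alpha> ` {0..1}" using assms(3) that by blast
    then obtain x where "x \<in> {0..1}" "\<alpha> x = Pt (Vx w)" by (elim imageE) simp
    then show ?thesis using const[of x] by (simp add: side_def)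
  qed
  have "u \<in> A" unfolding A_def by auto
  then have "v \<in> A" using pot[OF uv(1)] pot[OF uv(2)] by (cases "v \<in> A") auto
  then show "(u, v) \<in> E\<^sup>*" unfolding A_def by auto
qed

section \<open>Walks and rays\<close>

definition walk :: "('v \<times> 'v) set \<Rightarrow> 'v set \<Rightarrow> 'v \<Rightarrow> 'v list \<Rightarrow> 'v \<Rightarrow> bool" where
  "walk E S a L b \<longleftrightarrow> L \<noteq> [] \<and> hd L = a \<and> last L = b \<and> set L \<subseteq> S \<and> successively (\<lambda>x y. (x, y) \<in> E) L"

text \<open>\<open>tl\<close> drops the second copy of the junction b, which would otherwise demand
  a loop at b.\<close>

lemma walk_append:
  assumes "walk E S a K b" "walk E S b L c"
  shows "walk E S a (K @ tl L) c" and "set (K @ tl L) = set K \<union> set L"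
proof -
  obtain ys where L: "L = b # ys" using assms(2) unfolding walk_def by (cases L) auto
  have K: "K \<noteq> []" "last K = b" using assms(1) by (auto simp: walk_def)
  then have "b \<in> set K" using last_in_set by metis
  then show "set (K @ tl L) = set K \<union> set L" by (auto simp: L)
  show "walk E S a (K @ tl L) c"
    using assms L K by (auto simp: walk_def successively_append_iff successively_Cons)
qed

lemma rtrancl_walk:
  assumes "(a, b) \<in> (E \<inter> S \<times> S)\<^sup>*" "a \<in> S"
  shows "\<exists>L. walk E S a L b"
  using assms(1)
proof (induction rule: rtrancl_induct)
  case base
  then show ?case using assms(2) by (intro exI[of _ "[a]"]) (simp add: walk_def)
next
  case (step y z)
  then obtain L where "walk E S a L y" by blast
  then have "walk E S a (L @ [z]) z"
    using step.hyps by (auto simp: walk_def successively_append_iff)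
  then show ?case by blast
qed

text \<open>For each r a detour from c to r and back is appended; returning to c every time keeps
  the walk closed.\<close>

lemma closed_walk_cover:
  assumes "finite R" "R \<subseteq> S" "c \<in> S"
    and "\<And>v. v \<in> S \<Longrightarrow> (c, v) \<in> (E \<inter> S \<times> S)\<^sup>* \<and> (v, c) \<in> (E \<inter> S \<times> S)\<^sup>*"
  shows "\<exists>L. walk E S c L c \<and> R \<subseteq> set L"
  using assms(1,2)
proof (induction R rule: finite_induct)
  case empty
  then show ?case using assms(3) by (intro exI[of _ "[c]"]) (simp add: walk_def)
next
  case (insert r R)
  then obtain L where L: "walk E S c L c" "R \<subseteq> set L" by auto
  have r: "r \<in> S" using insert.prems by simp
  obtain P Q where P: "walk E S c P r" and Q: "walk E S r Q c"
    using rtrancl_walk[of c r E S] rtrancl_walk[of r c E S] assms(3) assms(4)[OF r] r by blast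
  have "r \<in> set Q" using Q unfolding walk_def by (metis hd_in_set)
  then have "insert r R \<subseteq> set ((L @ tl P) @ tl Q)"
    using L walk_append[OF L(1) P] walk_append(2)[OF walk_append(1)[OF L(1) P] Q] by blast
  then show ?case using walk_append(1)[OF walk_append(1)[OF L(1) P] Q] by blast
qed

text \<open>Walks in R n from c n to c (Suc n) are strung together. The transitive closure makes
  every segment nonempty, so the combined walk takes a genuine step at every index.\<close>

lemma infinite_walk_concat:
  fixes R :: "nat \<Rightarrow> ('a \<times> 'a) set"
  assumes dec: "\<And>n. R (Suc n) \<subseteq> R n" and conn: "\<And>n. (c n, c (Suc n)) \<in> (R n)\<^sup>+"
  shows "\<exists>w. (\<forall>i. (w i, w (Suc i)) \<in> R 0) \<and> (\<forall>n. \<exists>k. \<forall>i\<ge>k. (w i, w (Suc i)) \<in> R n)"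
proof -
  have conn': "\<exists>k. (c n, c (Suc n)) \<in> R n ^^ Suc k" for n
    using conn[of n] by (auto simp: trancl_power gr0_conv_Suc)
  \<comment> \<open>A state (n, k, v) means: on segment n, at v, with Suc k steps left to c (Suc n).
    When k = 0, the next step ends the segment and the countdown restarts on segment n + 1.\<close>
  define P where "P = (\<lambda>(n, k, v). (v, c (Suc n)) \<in> R n ^^ Suc k)"
  define Q where "Q = (\<lambda>(n, k, v) (n', k', v'). (v, v') \<in> R n \<and>
    (k = 0 \<and> n' = Suc n \<or> k = Suc k' \<and> n' = n))"
  have "\<exists>f. \<forall>i::nat. P (f i) \<and> Q (f i) (f (Suc i))"
  proof (rule dependent_nat_choice)
    show "\<exists>s. P s" using conn'[of 0] by (auto simp: P_def)
    fix s :: "nat \<times> nat \<times> 'a" and i :: nat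
    obtain n k v where s: "s = (n, k, v)" by (cases s)
    assume "P s"
    then have v: "(v, c (Suc n)) \<in> R n ^^ Suc k" by (simp add: P_def s)
    show "\<exists>s'. P s' \<and> Q s s'"
    proof (cases k)
      case 0
      obtain k' where "(c (Suc n), c (Suc (Suc n))) \<in> R (Suc n) ^^ Suc k'" using conn' by blast
      then show ?thesis using v 0 by (intro exI[of _ "(Suc n, k', c (Suc n))"]) (simp add: P_def Q_def s)
    next
      case (Suc k')
      obtain v' where "(v, v') \<in> R n" "(v', c (Suc n)) \<in> R n ^^ Suc k'"
        using v Suc relpow_Suc_D2[of v "c (Suc n)" "Suc k'" "R n"] by blast
      then show ?thesis using Suc by (intro exI[of _ "(n, k', v')"]) (simp add: P_def Q_def s)
    qed
  qed
  then obtain f where f: "\<And>i. Q (f i) (f (Suc i))" by blast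
  define N K w where "N i = fst (f i)" and "K i = fst (snd (f i))" and "w i = snd (snd (f i))" for i
  have step: "(w i, w (Suc i)) \<in> R (N i)"
    "K i = 0 \<and> N (Suc i) = Suc (N i) \<or> K i = Suc (K (Suc i)) \<and> N (Suc i) = N i" for i
    using f[of i] by (auto simp: Q_def N_def K_def w_def case_prod_beta)
  \<comment> \<open>Every countdown runs out, so the segment index is unbounded.\<close>
  have prog: "\<exists>j. N j = Suc (N i)" for i
  proof (induction "K i" arbitrary: i)
    case 0
    then show ?case using step(2)[of i] by auto
  next
    case (Suc k)
    then have "k = K (Suc i)" "N (Suc i) = N i" using step(2)[of i] by auto
    then show ?case using Suc.hyps(1)[of "Suc i"] by simp
  qed
  have "\<exists>i. n \<le> N i" for n
  proof (induction n)
    case (Suc n)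
    then obtain i where "n \<le> N i" by blast
    then show ?case using prog[of i] by (metis Suc_le_mono)
  qed simp
  moreover have "N i \<le> N (Suc i)" for i using step(2)[of i] by auto
  then have mono: "i \<le> j \<Longrightarrow> N i \<le> N j" for i j using lift_Suc_mono_le[of N] by blast
  have Rm: "R m \<subseteq> R n" if "n \<le> m" for n m
    using lift_Suc_antimono_le[of R, OF dec that] .
  have "\<exists>k. \<forall>i\<ge>k. (w i, w (Suc i)) \<in> R n" for n
  proof -
    obtain k where k: "n \<le> N k" using \<open>\<And>n. \<exists>i. n \<le> N i\<close> by blast
    have "(w i, w (Suc i)) \<in> R n" if "k \<le> i" for i
      using step(1)[of i] Rm[OF le_trans[OF k mono[OF that]]] by blast
    then show ?thesis by blast
  qed
  moreover have "(w i, w (Suc i)) \<in> R 0" for i using step(1)[of i] Rm[of 0 "N i"] by blast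
  ultimately show ?thesis by blast
qed

text \<open>Jumping from each vertex of the walk to its last visit erases all loops.\<close>
lemma walk_contains_ray:
  assumes w: "\<And>i. (w i, w (Suc i)) \<in> E" and fin: "\<And>v. finite {i. w i = v}"
  shows "\<exists>\<sigma>. strict_mono \<sigma> \<and> inj (w \<circ> \<sigma>) \<and> (\<forall>k. (w (\<sigma> k), w (\<sigma> (Suc k))) \<in> E)"
proof -
  define l where "l i = Max {j. w j = w i}" for i
  have "l i \<in> {j. w j = w i}" for i unfolding l_def using fin by (intro Max_in) auto
  then have wl: "w (l i) = w i" for i by simp
  have le: "j \<le> l i" if "w j = w i" for i j unfolding l_def using fin that by (intro Max_ge) auto
  define \<sigma> where "\<sigma> = rec_nat (l 0) (\<lambda>_ s. l (Suc s))"
  have \<sigma>: "\<sigma> (Suc k) = l (Suc (\<sigma> k))" for k by (simp add: \<sigma>_def)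
  have "Suc (\<sigma> k) \<le> \<sigma> (Suc k)" for k unfolding \<sigma> by (rule le) simp
  then have mono: "strict_mono \<sigma>" by (auto simp: strict_mono_Suc_iff Suc_le_eq)
  have "\<exists>i. \<sigma> k = l i" for k by (cases k) (auto simp: \<sigma>_def)
  then have last: "j \<le> \<sigma> k" if "w j = w (\<sigma> k)" for j k using le wl that by metis
  have "inj (w \<circ> \<sigma>)"
  proof (rule injI)
    fix k k' assume "(w \<circ> \<sigma>) k = (w \<circ> \<sigma>) k'"
    then have "\<sigma> k = \<sigma> k'" using last[of "\<sigma> k" k'] last[of "\<sigma> k'" k] by simp
    then show "k = k'" using mono by (simp add: strict_mono_eq)
  qed
  moreover have "(w (\<sigma> k), w (\<sigma> (Suc k))) \<in> E" for k using w[of "\<sigma> k"] wl \<sigma> by simp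
  ultimately show ?thesis using mono by blast
qed

section \<open>The partitions of a strongly connected solid digraph\<close>

text \<open>The enumeration \<open>e\<close> is only required to have range V; repetitions are
  allowed so that finite vertex sets are covered too.\<close>

locale enumerated_digraph =
  fixes V :: "'v set" and E :: "('v \<times> 'v) set" and e :: "nat \<Rightarrow> 'v"
  assumes digraph: "digraph V E"
    and range_e: "range e = V"
    and solid: "solid V E"
    and connected: "strongly_connected V E"
begin

abbreviation X :: "nat \<Rightarrow> 'v set" where
  "X n \<equiv> e ` {..<n}"

definition part :: "nat \<Rightarrow> 'v \<Rightarrow> 'v set" where
  "part n c = (if c \<in> X n then {c} else {v \<in> V - X n. sreach E (V - X n) c v})"

section \<open>Elementary properties of the classes\<close>

lemma X_subset: "X n \<subseteq> V"
  using range_e by auto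

lemma vertex_in_X: "v \<in> V \<Longrightarrow> \<exists>n. v \<in> X n"
  using range_e by (metis image_eqI lessThan_iff lessI rangeE)

lemma X_mono: "n \<le> m \<Longrightarrow> X n \<subseteq> X m"
  by auto

lemma finite_subset_X:
  assumes "finite Y" "Y \<subseteq> V"
  shows "\<exists>n. Y \<subseteq> X n"
  using assms
proof (induction Y rule: finite_induct)
  case (insert y Y)
  then obtain n k where n: "Y \<subseteq> X n" and k: "y \<in> X k" using vertex_in_X[of y] by auto
  then have "insert y Y \<subseteq> X (max n k)"
    using X_mono[of n "max n k"] X_mono[of k "max n k"] by fastforce
  then show ?case by blast
qed simp

lemma part_self: "c \<in> V \<Longrightarrow> c \<in> part n c"
  by (simp add: part_def sreach_refl)

lemma part_subset: "c \<in> V \<Longrightarrow> part n c \<subseteq> V"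
  by (auto simp: part_def)

lemma part_X: "c \<in> X n \<Longrightarrow> part n c = {c}"
  by (simp add: part_def)

lemma part_strong_component:
  "c \<in> V \<Longrightarrow> c \<notin> X n \<Longrightarrow> part n c \<in> strong_components (V - X n) E"
  using strong_componentI[of c "V - X n" E] by (simp add: part_def)

lemma part_disjoint_X: "c \<notin> X n \<Longrightarrow> v \<in> part n c \<Longrightarrow> v \<notin> X n"
  by (simp add: part_def)

lemma part_eq:
  assumes "c \<in> V" "v \<in> part n c"
  shows "part n v = part n c"
proof (cases "c \<in> X n")
  case True
  then show ?thesis using assms(2) by (simp add: part_X)
next
  case False
  then have "part n c = {w \<in> V - X n. sreach E (V - X n) v w}"
    using strong_component_eq[OF part_strong_component] assms by blast
  then show ?thesis using part_disjoint_X[OF False assms(2)] by (simp add: part_def)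
qed

lemma part_Suc: "c \<in> V \<Longrightarrow> part (Suc n) c \<subseteq> part n c"
proof (cases "c \<in> X (Suc n)")
  case True
  assume "c \<in> V"
  then show ?thesis using True part_self by (simp add: part_X)
next
  case False
  have "X n \<subseteq> X (Suc n)" by (rule X_mono) simp
  then have "V - X (Suc n) \<subseteq> V - X n" "c \<notin> X n" using False by auto
  then show ?thesis using False sreach_mono[of "V - X (Suc n)" "V - X n" E c] by (auto simp: part_def)
qed

lemma part_antimono: "n \<le> m \<Longrightarrow> c \<in> V \<Longrightarrow> part m c \<subseteq> part n c"
  by (induction m rule: dec_induct) (use part_Suc in blast)+

lemma part_connected:
  assumes "c \<in> V" "v \<in> part n c"
  shows "(c, v) \<in> (E \<inter> part n c \<times> part n c)\<^sup>*"
proof (cases "c \<in> X n")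
  case True
  then show ?thesis using assms by (simp add: part_X)
next
  case False
  then have eq: "part n c = {w \<in> V - X n. sreach E (V - X n) c w}" by (simp add: part_def)
  show ?thesis using sreach_inside[of c "V - X n" E v] assms False unfolding eq by simp
qed

lemma part_connected':
  assumes "c \<in> V" "u \<in> part n c" "v \<in> part n c"
  shows "(u, v) \<in> (E \<inter> part n c \<times> part n c)\<^sup>*"
proof -
  have "u \<in> V" using assms part_subset by blast
  then show ?thesis using part_connected[of u v n] part_eq[OF assms(1,2)] assms(3) by simp
qed

text \<open>Strong connectivity enters here: stage 0 has a single class, so the trivial walk at
  \<open>e 0\<close> meets every class of that stage.\<close>

lemma part_0: "c \<in> V \<Longrightarrow> part 0 c = V"
proof -
  assume c: "c \<in> V"
  have "E \<inter> V \<times> V = E" using digraph by (auto simp: digraph_def)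
  then show ?thesis using connected c by (auto simp: part_def sreach_def strongly_connected_def)
qed

text \<open>Solidity enters here; it lets one finite walk meet all subclasses of a class.\<close>

lemma finite_parts: "finite (part n ` V)"
proof -
  have "part n ` V \<subseteq> strong_components (V - X n) E \<union> (\<lambda>c. {c}) ` X n"
  proof
    fix P assume "P \<in> part n ` V"
    then obtain c where "c \<in> V" "P = part n c" by blast
    then show "P \<in> strong_components (V - X n) E \<union> (\<lambda>c. {c}) ` X n"
      using part_strong_component[of c n] part_X[of c n] by (cases "c \<in> X n") blast+
  qed
  moreover have "finite (strong_components (V - X n) E)"
    using solid X_subset[of n] unfolding solid_def by simp
  ultimately show ?thesis using finite_subset by blast
qed

text \<open>One representative is chosen from each of the finitely many next classes that meet
  \<open>part n c\<close>, and a closed walk at c is led through all of them.\<close>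

lemma refinement_exists:
  assumes c: "c \<in> V"
  shows "\<exists>L. walk E (part n c) c L c \<and> (\<forall>v\<in>part n c. \<exists>c'\<in>set L. v \<in> part (Suc n) c')"
proof -
  have sub: "part n c \<subseteq> V" using part_subset[OF c] .
  have "finite (part (Suc n) ` part n c)"
    using finite_parts[of "Suc n"] sub by (meson finite_subset image_mono)
  from finite_subset_image[OF this order_refl]
  obtain R where R: "R \<subseteq> part n c" "finite R" "part (Suc n) ` part n c = part (Suc n) ` R"
    by (elim exE conjE)
  obtain L where L: "walk E (part n c) c L c" "R \<subseteq> set L"
    using closed_walk_cover[OF R(2,1) part_self[OF c], of E]
      part_connected'[OF c part_self[OF c]] part_connected'[OF c _ part_self[OF c]] by blast
  have "\<exists>c'\<in>set L. v \<in> part (Suc n) c'" if v: "v \<in> part n c" for v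
  proof -
    have "part (Suc n) v \<in> part (Suc n) ` R" using v unfolding R(3)[symmetric] by (rule imageI)
    then obtain r where "r \<in> R" "part (Suc n) r = part (Suc n) v" by (elim imageE) simp
    moreover have "v \<in> part (Suc n) v" using part_self sub v by blast
    ultimately show ?thesis using L(2) by blast
  qed
  then show ?thesis using L(1) by blast
qed

definition refine :: "nat \<Rightarrow> 'v \<Rightarrow> 'v list" where
  "refine n c = (SOME L. walk E (part n c) c L c \<and> (\<forall>v\<in>part n c. \<exists>c'\<in>set L. v \<in> part (Suc n) c'))"

lemma refine_props:
  assumes "c \<in> V"
  shows "walk E (part n c) c (refine n c) c" "v \<in> part n c \<Longrightarrow> \<exists>c'\<in>set (refine n c). v \<in> part (Suc n) c'"
  using someI_ex[OF refinement_exists[OF assms, of n]] unfolding refine_def by blast+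

text \<open>The classes \<open>part n (c n)\<close> decrease and eventually avoid every given
  vertex. Walks joining consecutive c n inside them form an infinite walk that visits each vertex
  finitely often; a ray extracted from it has a tail in every class. For Y \<subseteq> X n the class
  is strongly connected in D - Y as well, so it lies in the component in which the end of that ray
  lives.\<close>

lemma end_exists:
  assumes c: "\<And>n. c n \<in> V" "\<And>n. c n \<notin> X n" "\<And>n. c (Suc n) \<in> part n (c n)"
  shows "\<exists>\<omega>\<in>ends V E. \<forall>n. \<forall>Y\<subseteq>X n. part n (c n) \<subseteq> comp_of V E Y \<omega>"
proof -
  define C where "C n = part n (c n)" for n
  have C_Suc: "C (Suc n) \<subseteq> C n" for n
    using part_Suc[OF c(1), of n "Suc n"] part_eq[OF c(1,3)] unfolding C_def by simp
  have C_anti: "n \<le> m \<Longrightarrow> C m \<subseteq> C n" for n m using lift_Suc_antimono_le[of C, OF C_Suc] .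
  have cC: "c m \<in> C n" if "n \<le> m" for n m
    using C_anti[OF that] part_self[OF c(1), of m m] unfolding C_def by blast
  define R where "R n = E \<inter> C n \<times> C n" for n
  have conn: "(u, v) \<in> (R n)\<^sup>*" if "u \<in> C n" "v \<in> C n" for u v n
    using part_connected'[OF c(1)] that unfolding C_def R_def by blast
  \<comment> \<open>c n and c (Suc n) may coincide, so the walk makes a detour through a different
    vertex y of C n, taken from a stage at which c n already belongs to X.\<close>
  have "(c n, c (Suc n)) \<in> (R n)\<^sup>+" for n
  proof -
    obtain k where k: "c n \<in> X k" using vertex_in_X c(1) by blast
    define y where "y = c (max n k)"
    have "y \<notin> X (max n k)" unfolding y_def by (rule c(2))
    then have "y \<noteq> c n" using k X_mono[of k "max n k"] by auto
    moreover have y: "y \<in> C n" unfolding y_def by (rule cC) simp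
    ultimately have "(c n, y) \<in> (R n)\<^sup>+" using conn[OF cC[of n n] y] by (auto simp: rtrancl_eq_or_trancl)
    then show ?thesis using conn[OF y cC[of n "Suc n"]] by auto
  qed
  moreover have "R (Suc n) \<subseteq> R n" for n using C_Suc unfolding R_def by blast
  ultimately obtain w where w0: "\<And>i. (w i, w (Suc i)) \<in> R 0"
    and w: "\<And>n. \<exists>k. \<forall>i\<ge>k. (w i, w (Suc i)) \<in> R n"
    using infinite_walk_concat[of R c] by blast
  have wC: "\<exists>k. \<forall>i\<ge>k. w i \<in> C n" for n using w[of n] unfolding R_def by blast
  have wV: "w i \<in> V" for i using w0[of i] digraph by (auto simp: R_def digraph_def)
  have "finite {i. w i = v}" for v
  proof (cases "v \<in> V")
    case True
    then obtain n where n: "v \<in> X n" using vertex_in_X by blast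
    obtain k where k: "\<forall>i\<ge>k. w i \<in> C n" using wC by blast
    have "v \<notin> C n" using n part_disjoint_X[OF c(2)] unfolding C_def by blast
    then have "{i. w i = v} \<subseteq> {..<k}" using k by (auto simp: not_le[symmetric])
    then show ?thesis using finite_subset by blast
  next
    case False
    then have "{i. w i = v} = {}" using wV by auto
    then show ?thesis by simp
  qed
  moreover have "(w i, w (Suc i)) \<in> E" for i using w0[of i] by (simp add: R_def)
  ultimately obtain \<sigma> where \<sigma>: "strict_mono \<sigma>" "inj (w \<circ> \<sigma>)" "\<And>k. (w (\<sigma> k), w (\<sigma> (Suc k))) \<in> E"
    using walk_contains_ray[of w E] by blast
  define r where "r = w \<circ> \<sigma>"
  have ray: "ray V E r" unfolding ray_def r_def using \<sigma> wV by auto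
  have tail: "tail_in r (C n)" for n
  proof -
    obtain k where "\<forall>i\<ge>k. w i \<in> C n" using wC by blast
    then have "\<forall>i\<ge>k. r i \<in> C n" using \<sigma>(1) seq_suble[of \<sigma>] unfolding r_def by (auto intro: le_trans)
    then show ?thesis unfolding tail_in_def by blast
  qed
  have sc: "\<exists>C'\<in>strong_components (V - Y) E. C n \<subseteq> C'" if "Y \<subseteq> X n" for Y n
  proof -
    have "C n \<in> strong_components (V - X n) E" unfolding C_def by (rule part_strong_component[OF c(1,2)])
    moreover have "V - X n \<subseteq> V - Y" using that by blast
    ultimately show ?thesis using strong_component_mono[of "C n" "V - X n" E "V - Y"] by blast
  qed
  have solid_r: "solid_ray V E r"
    unfolding solid_ray_def
  proof (intro conjI allI impI ray)
    fix Y assume "finite Y \<and> Y \<subseteq> V"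
    then obtain n where "Y \<subseteq> X n" using finite_subset_X by blast
    then obtain C' where "C' \<in> strong_components (V - Y) E" "C n \<subseteq> C'" using sc by blast
    then show "\<exists>C\<in>strong_components (V - Y) E. tail_in r C"
      using tail_in_mono[OF tail] by (intro bexI[of _ C'])
  qed
  define \<omega> where "\<omega> = {s. equiv_rays V E r s}"
  have \<omega>: "\<omega> \<in> ends V E" "r \<in> \<omega>"
    unfolding \<omega>_def ends_def using solid_r equiv_rays_refl by auto
  have "part n (c n) \<subseteq> comp_of V E Y \<omega>" if Y: "Y \<subseteq> X n" for n Y
  proof -
    obtain C' where C': "C' \<in> strong_components (V - Y) E" "C n \<subseteq> C'" using sc[OF Y] by blast
    have "finite Y" using Y finite_subset by blast
    moreover have "Y \<subseteq> V" using Y X_subset by blast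
    ultimately have "comp_of V E Y \<omega> = C'"
      using \<omega> C'(1) tail_in_mono[OF tail C'(2)] by (intro comp_of_eqI)
    then show ?thesis using C'(2) by (simp add: C_def)
  qed
  then show ?thesis using \<omega>(1) by blast
qed

end

section \<open>Time cells\<close>

text \<open>A finite approximation of the path assigns to each time either a vertex of the current
  closed walk, together with the closed interval \<open>{p..q}\<close> it is visited, or the edge
  traversed during the open interval \<open>{p<..<q}\<close>.\<close>
datatype 'v cell = Blk 'v real real | Ed 'v 'v real real

text \<open>Records what precedes a block: the start of the whole time interval, or the interval of
  an edge that enters c exactly at time p. Continuity from the left at a vertex is read off from
  this; \<open>right_end\<close> is its mirror image.\<close>

definition left_end :: "real \<Rightarrow> 'v \<Rightarrow> (real \<Rightarrow> 'v cell) \<Rightarrow> 'v \<Rightarrow> real \<Rightarrow> bool" where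
  "left_end P a g c p \<longleftrightarrow> p = P \<and> c = a \<or>
     (\<exists>d p0. P \<le> p0 \<and> p0 < p \<and> (\<forall>y\<in>{p0<..<p}. g y = Ed d c p0 p))"

definition right_end :: "real \<Rightarrow> 'v \<Rightarrow> (real \<Rightarrow> 'v cell) \<Rightarrow> 'v \<Rightarrow> real \<Rightarrow> bool" where
  "right_end Q b g c q \<longleftrightarrow> q = Q \<and> c = b \<or>
     (\<exists>d q0. q < q0 \<and> q0 \<le> Q \<and> (\<forall>y\<in>{q<..<q0}. g y = Ed c d q q0))"

text \<open>Cells carry their own bounds, so consistency can be stated as constancy of g on each
  cell. The strict bounds on edge cells make the first and last cells blocks, whose vertices must be
  a and b.\<close>

definition tracks :: "('v \<times> 'v) set \<Rightarrow> real \<Rightarrow> real \<Rightarrow> 'v \<Rightarrow> 'v \<Rightarrow> (real \<Rightarrow> 'v cell) \<Rightarrow> bool" where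
  "tracks E P Q a b g \<longleftrightarrow> (\<forall>x\<in>{P..Q}.
     (\<forall>c p q. g x = Blk c p q \<longrightarrow> P \<le> p \<and> p < q \<and> q \<le> Q \<and> p \<le> x \<and> x \<le> q \<and>
        (\<forall>y\<in>{p..q}. g y = Blk c p q) \<and> left_end P a g c p \<and> right_end Q b g c q) \<and>
     (\<forall>u w p q. g x = Ed u w p q \<longrightarrow> (u, w) \<in> E \<and> P < p \<and> p < x \<and> x < q \<and> q < Q \<and>
        (\<forall>y\<in>{p<..<q}. g y = Ed u w p q) \<and>
        (\<exists>p0. g p = Blk u p0 p) \<and> (\<exists>q0. g q = Blk w q q0)))"

lemma tracks_Blk:
  assumes "tracks E P Q a b g" "x \<in> {P..Q}" "g x = Blk c p q"
  shows "P \<le> p" "p < q" "q \<le> Q" "p \<le> x" "x \<le> q" "\<And>y. y \<in> {p..q} \<Longrightarrow> g y = Blk c p q"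
    "left_end P a g c p" "right_end Q b g c q"
  using assms unfolding tracks_def by blast+

lemma tracks_Ed:
  assumes "tracks E P Q a b g" "x \<in> {P..Q}" "g x = Ed u w p q"
  shows "(u, w) \<in> E" "P < p" "p < x" "x < q" "q < Q" "\<And>y. y \<in> {p<..<q} \<Longrightarrow> g y = Ed u w p q"
    "\<exists>p0. g p = Blk u p0 p" "\<exists>q0. g q = Blk w q q0"
  using assms unfolding tracks_def by blast+

lemma tracks_start:
  assumes "tracks E P Q a b g" "P \<le> Q"
  shows "\<exists>q. g P = Blk a P q"
proof (cases "g P")
  case (Blk c p q)
  note * = tracks_Blk[OF assms(1) _ Blk]
  have "p = P" using *(1,4) assms(2) by simp
  moreover have "left_end P a g c p" using *(7) assms(2) by simp
  ultimately show ?thesis using Blk by (auto simp: left_end_def)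
next
  case (Ed u w p q)
  then show ?thesis using tracks_Ed(2,3)[OF assms(1) _ Ed] assms(2) by simp
qed

lemma tracks_finish:
  assumes "tracks E P Q a b g" "P \<le> Q"
  shows "\<exists>p. g Q = Blk b p Q"
proof (cases "g Q")
  case (Blk c p q)
  note * = tracks_Blk[OF assms(1) _ Blk]
  have "q = Q" using *(3,5) assms(2) by simp
  moreover have "right_end Q b g c q" using *(8) assms(2) by simp
  ultimately show ?thesis using Blk by (auto simp: right_end_def)
next
  case (Ed u w p q)
  then show ?thesis using tracks_Ed(4,5)[OF assms(1) _ Ed] assms(2) by simp
qed

text \<open>Thirds give the visit of c and the following edge positive length and leave room for the
  rest of the walk. The comparison signs make blocks closed and edge intervals open. The empty list
  gets a default value; the walks inserted later are nonempty.\<close>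

fun locate :: "real \<Rightarrow> real \<Rightarrow> 'v list \<Rightarrow> real \<Rightarrow> 'v cell" where
  "locate p q [] x = Blk undefined p q"
| "locate p q [c] x = Blk c p q"
| "locate p q (c # d # L) x =
    (if x \<le> p + (q - p) / 3 then Blk c p (p + (q - p) / 3)
     else if x < p + 2 * (q - p) / 3 then Ed c d (p + (q - p) / 3) (p + 2 * (q - p) / 3)
     else locate (p + 2 * (q - p) / 3) q (d # L) x)"

lemma locate_Blk_in: "L \<noteq> [] \<Longrightarrow> locate p q L x = Blk c p' q' \<Longrightarrow> c \<in> set L"
  by (induction p q L x rule: locate.induct) (auto split: if_splits)

lemma locate_Ed_in: "locate p q L x = Ed u w p' q' \<Longrightarrow> u \<in> set L \<and> w \<in> set L"
  by (induction p q L x rule: locate.induct) (auto split: if_splits)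

lemma locate_hits:
  assumes "p < q" "c \<in> set L"
  shows "\<exists>x\<in>{p..q}. \<exists>p' q'. locate p q L x = Blk c p' q'"
  using assms
proof (induction L arbitrary: p rule: induct_list012)
  case (2 d)
  then show ?case by (intro bexI[of _ p]) auto
next
  case (3 a b L)
  show ?case
  proof (cases "c = a")
    case True
    then show ?thesis using 3(3) by (intro bexI[of _ p]) auto
  next
    case False
    let ?m = "p + 2 * (q - p) / 3"
    have m: "p + (q - p) / 3 < ?m" "?m < q" using 3(3) by (auto simp: field_simps)
    then obtain x p' q' where x: "x \<in> {?m..q}" "locate ?m q (b # L) x = Blk c p' q'"
      using 3(2)[of ?m] 3(4) False by auto
    have "\<not> x \<le> p + (q - p) / 3" "\<not> x < ?m"
      using x(1) m(1) unfolding atLeastAtMost_iff by linarith+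
    then have "locate p q (a # b # L) x = Blk c p' q'" using x(2) by simp
    moreover have "x \<in> {p..q}" using x(1) m 3(3) unfolding atLeastAtMost_iff by linarith
    ultimately show ?thesis by blast
  qed
qed simp

text \<open>The inductive step of \<open>locate_tracks\<close>, with abstract cut points. Among the
  cells of h only the first block changes status at its left end: it no longer starts the time
  interval but is entered by the new edge.\<close>

lemma tracks_Cons:
  assumes pm: "p < m1" "m1 < m2" "m2 < q" and cd: "(c, d) \<in> E" and h: "tracks E m2 q d b h"
  shows "tracks E p q c b (\<lambda>x. if x \<le> m1 then Blk c p m1 else if x < m2 then Ed c d m1 m2 else h x)"
    (is "tracks E p q c b ?g")
  unfolding tracks_def
proof (intro ballI)
  fix x assume x: "x \<in> {p..q}"
  consider "x \<le> m1" | "m1 < x" "x < m2" | "m2 \<le> x" by linarith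
  then show "(\<forall>c' p' q'. ?g x = Blk c' p' q' \<longrightarrow> p \<le> p' \<and> p' < q' \<and> q' \<le> q \<and> p' \<le> x \<and> x \<le> q' \<and>
        (\<forall>y\<in>{p'..q'}. ?g y = Blk c' p' q') \<and> left_end p c ?g c' p' \<and> right_end q b ?g c' q') \<and>
     (\<forall>u w p' q'. ?g x = Ed u w p' q' \<longrightarrow> (u, w) \<in> E \<and> p < p' \<and> p' < x \<and> x < q' \<and> q' < q \<and>
        (\<forall>y\<in>{p'<..<q'}. ?g y = Ed u w p' q') \<and>
        (\<exists>p0. ?g p' = Blk u p0 p') \<and> (\<exists>q0. ?g q' = Blk w q' q0))"
  proof cases
    case 1
    have "right_end q b ?g c m1"
      unfolding right_end_def using pm by (intro disjI2 exI[of _ d] exI[of _ m2]) auto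
    then show ?thesis using 1 x pm by (auto simp: left_end_def)
  next
    case 2
    then show ?thesis using pm cd tracks_start[OF h] by auto
  next
    case 3
    then have x2: "x \<in> {m2..q}" "?g x = h x" using x pm by auto
    show ?thesis
    proof (cases "h x")
      case (Blk c' p' q')
      note * = tracks_Blk[OF h x2(1) Blk]
      have "?g y = Blk c' p' q'" if "y \<in> {p'..q'}" for y
        using *(1,6) that pm by auto
      moreover have "left_end p c ?g c' p'"
        using *(7) unfolding left_end_def
      proof (elim disjE exE conjE)
        assume "p' = m2" "c' = d"
        then show "p' = p \<and> c' = c \<or> (\<exists>d p0. p \<le> p0 \<and> p0 < p' \<and> (\<forall>y\<in>{p0<..<p'}. ?g y = Ed d c' p0 p'))"
          using pm by (intro disjI2 exI[of _ c] exI[of _ m1]) auto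
      next
        fix d' p0 assume "m2 \<le> p0" "p0 < p'" "\<forall>y\<in>{p0<..<p'}. h y = Ed d' c' p0 p'"
        then show "p' = p \<and> c' = c \<or> (\<exists>d p0. p \<le> p0 \<and> p0 < p' \<and> (\<forall>y\<in>{p0<..<p'}. ?g y = Ed d c' p0 p'))"
          using pm by (intro disjI2 exI[of _ d'] exI[of _ p0]) auto
      qed
      moreover have "right_end q b ?g c' q'"
        using *(8) unfolding right_end_def
      proof (elim disjE exE conjE)
        fix d' q0 assume "q' < q0" "q0 \<le> q" "\<forall>y\<in>{q'<..<q0}. h y = Ed c' d' q' q0"
        then show "q' = q \<and> c' = b \<or> (\<exists>d q0. q' < q0 \<and> q0 \<le> q \<and> (\<forall>y\<in>{q'<..<q0}. ?g y = Ed c' d q' q0))"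
          using pm *(1,2) by (intro disjI2 exI[of _ d'] exI[of _ q0]) auto
      qed simp
      ultimately show ?thesis using *(1-5) pm unfolding x2(2) Blk by auto
    next
      case (Ed u w p' q')
      note * = tracks_Ed[OF h x2(1) Ed]
      have "?g y = Ed u w p' q'" if "y \<in> {p'<..<q'}" for y
        using *(2,6) that pm by auto
      moreover have "\<exists>p0. ?g p' = Blk u p0 p'" "\<exists>q0. ?g q' = Blk w q' q0"
        using *(2,3,4,7,8) pm by auto
      ultimately show ?thesis using *(1-5) pm unfolding x2(2) Ed by auto
    qed
  qed
qed

lemma locate_tracks:
  assumes "p < q" "L \<noteq> []" "successively (\<lambda>x y. (x, y) \<in> E) L"
  shows "tracks E p q (hd L) (last L) (locate p q L)"
  using assms
proof (induction L arbitrary: p rule: induct_list012)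
  case (2 c)
  then show ?case by (auto simp: tracks_def left_end_def right_end_def)
next
  case (3 c d L)
  let ?m1 = "p + (q - p) / 3" and ?m2 = "p + 2 * (q - p) / 3"
  have m: "p < ?m1" "?m1 < ?m2" "?m2 < q" using 3(3) by (auto simp: field_simps)
  have "tracks E ?m2 q d (last (d # L)) (locate ?m2 q (d # L))"
    using 3(2)[of ?m2] 3(5) m by auto
  moreover have "(c, d) \<in> E" using 3(5) by simp
  ultimately show ?case using tracks_Cons[OF m, of c d E "last (d # L)" "locate ?m2 q (d # L)"]
    by simp
qed simp

text \<open>Substitution fits because an inserted walk starts and ends at the vertex c it replaces:
  edges next to the old block still meet a block of c, and the first and last new blocks inherit its
  neighbours.\<close>

lemma tracks_refine:
  assumes g: "tracks E P Q a b g"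
    and h: "\<And>c p q x. x \<in> {P..Q} \<Longrightarrow> g x = Blk c p q \<Longrightarrow> tracks E p q c c (h c p q)"
  shows "tracks E P Q a b (\<lambda>x. case g x of Blk c p q \<Rightarrow> h c p q x | Ed u w p q \<Rightarrow> Ed u w p q)"
    (is "tracks E P Q a b ?g")
  unfolding tracks_def
proof (intro ballI)
  fix x assume x: "x \<in> {P..Q}"
  show "(\<forall>c p q. ?g x = Blk c p q \<longrightarrow> P \<le> p \<and> p < q \<and> q \<le> Q \<and> p \<le> x \<and> x \<le> q \<and>
        (\<forall>y\<in>{p..q}. ?g y = Blk c p q) \<and> left_end P a ?g c p \<and> right_end Q b ?g c q) \<and>
     (\<forall>u w p q. ?g x = Ed u w p q \<longrightarrow> (u, w) \<in> E \<and> P < p \<and> p < x \<and> x < q \<and> q < Q \<and>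
        (\<forall>y\<in>{p<..<q}. ?g y = Ed u w p q) \<and>
        (\<exists>p0. ?g p = Blk u p0 p) \<and> (\<exists>q0. ?g q = Blk w q q0))"
  proof (cases "g x")
    case (Ed u w p q)
    note * = tracks_Ed[OF g x Ed]
    obtain p0 q0 where pq: "g p = Blk u p0 p" "g q = Blk w q q0" using *(7,8) by blast
    have pqin: "p \<in> {P..Q}" "q \<in> {P..Q}" using *(2-5) by auto
    have "\<exists>p0. ?g p = Blk u p0 p"
      using tracks_finish[OF h[OF pqin(1) pq(1)]] tracks_Blk(2)[OF g pqin(1) pq(1)] pq by simp
    moreover have "\<exists>q0. ?g q = Blk w q q0"
      using tracks_start[OF h[OF pqin(2) pq(2)]] tracks_Blk(2)[OF g pqin(2) pq(2)] pq by simp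
    ultimately show ?thesis using * Ed by simp
  next
    case (Blk c p q)
    note * = tracks_Blk[OF g x Blk]
    have H: "tracks E p q c c (h c p q)" using h[OF x Blk] .
    have xin: "x \<in> {p..q}" using *(4,5) by simp
    have gh: "?g y = h c p q y" if "y \<in> {p..q}" for y using *(6)[OF that] by simp
    show ?thesis
    proof (cases "h c p q x")
      case (Ed u w p' q')
      note ** = tracks_Ed[OF H xin Ed]
      have "p' \<in> {p..q}" "q' \<in> {p..q}" using **(2-5) by auto
      then have "\<exists>p0. ?g p' = Blk u p0 p'" "\<exists>q0. ?g q' = Blk w q' q0"
        using **(7,8) gh by simp_all
      moreover have "?g y = Ed u w p' q'" if "y \<in> {p'<..<q'}" for y
        using **(6)[OF that] gh[of y] that **(2,5) by simp
      ultimately show ?thesis using **(1-5) *(1,3) unfolding gh[OF xin] Ed by auto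
    next
      case (Blk c' p' q')
      note ** = tracks_Blk[OF H xin Blk]
      have gy: "?g y = Blk c' p' q'" if "y \<in> {p'..q'}" for y
        using **(6)[OF that] gh[of y] that **(1,3) by simp
      have "left_end P a ?g c' p'"
        using **(7) unfolding left_end_def[of p]
      proof (elim disjE exE conjE)
        assume eq: "p' = p" "c' = c"
        show ?thesis
          using *(7) unfolding left_end_def
        proof (elim disjE exE conjE)
          fix d p0 assume "P \<le> p0" "p0 < p" "\<forall>y\<in>{p0<..<p}. g y = Ed d c p0 p"
          then show "p' = P \<and> c' = a \<or> (\<exists>d p0. P \<le> p0 \<and> p0 < p' \<and> (\<forall>y\<in>{p0<..<p'}. ?g y = Ed d c' p0 p'))"
            unfolding eq by (intro disjI2 exI[of _ d] exI[of _ p0]) simp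
        qed (simp add: eq)
      next
        fix d p0 assume A: "p \<le> p0" "p0 < p'" "\<forall>y\<in>{p0<..<p'}. h c p q y = Ed d c' p0 p'"
        then have "\<forall>y\<in>{p0<..<p'}. ?g y = Ed d c' p0 p'" using gh **(2,3) by auto
        then show ?thesis unfolding left_end_def using A *(1) by (intro disjI2 exI[of _ d] exI[of _ p0]) simp
      qed
      moreover have "right_end Q b ?g c' q'"
        using **(8) unfolding right_end_def[of q]
      proof (elim disjE exE conjE)
        assume eq: "q' = q" "c' = c"
        show ?thesis
          using *(8) unfolding right_end_def
        proof (elim disjE exE conjE)
          fix d q0 assume "q < q0" "q0 \<le> Q" "\<forall>y\<in>{q<..<q0}. g y = Ed c d q q0"
          then show "q' = Q \<and> c' = b \<or> (\<exists>d q0. q' < q0 \<and> q0 \<le> Q \<and> (\<forall>y\<in>{q'<..<q0}. ?g y = Ed c' d q' q0))"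
            unfolding eq by (intro disjI2 exI[of _ d] exI[of _ q0]) simp
        qed (simp add: eq)
      next
        fix d q0 assume A: "q' < q0" "q0 \<le> q" "\<forall>y\<in>{q'<..<q0}. h c p q y = Ed c' d q' q0"
        then have "\<forall>y\<in>{q'<..<q0}. ?g y = Ed c' d q' q0" using gh **(1,2) by auto
        then show ?thesis unfolding right_end_def using A *(3) by (intro disjI2 exI[of _ d] exI[of _ q0]) simp
      qed
      ultimately show ?thesis using **(1-5) *(1,3) gy unfolding gh[OF xin] Blk by auto
    qed
  qed
qed

section \<open>The closed path through all vertices\<close>

text \<open>For continuity inside an edge: on a single edge every generator is cut out by finitely
  many strict inequalities in t and conditions independent of t.\<close>

lemma open_inner_slice:
  assumes "U \<in> gen_sets V E"
  shows "open {t. 0 < t \<and> t < 1 \<and> Inner a b t \<in> U}"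
  using assms
proof (cases rule: gen_sets_cases)
  case (star v \<epsilon>)
  have "{t. 0 < t \<and> t < 1 \<and> Inner a b t \<in> U} = {t. 0 < t \<and> t < 1 \<and> (a, b) \<in> all_edges V E \<and>
      (a = Vx v \<and> t < \<epsilon> \<or> b = Vx v \<and> 1 - \<epsilon> < t)}"
    by (auto simp: star(1) star_set_def)
  also have "open \<dots>"
    by (intro open_Collect_conj open_Collect_disj open_Collect_const open_Collect_less continuous_intros)
  finally show ?thesis .
next
  case (edge u w p q)
  have "{t. 0 < t \<and> t < 1 \<and> Inner a b t \<in> U} =
      {t. 0 < t \<and> t < 1 \<and> (a = Vx u \<and> b = Vx w) \<and> p < t \<and> t < q}"
    by (auto simp: edge(1))
  also have "open \<dots>"
    by (intro open_Collect_conj open_Collect_disj open_Collect_const open_Collect_less continuous_intros)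
  finally show ?thesis .
next
  case (comp Y \<omega> \<epsilon>)
  let ?L = "\<lambda>y. lives_in V E Y y (comp_of V E Y \<omega>)"
  have "{t. 0 < t \<and> t < 1 \<and> Inner a b t \<in> U} = {t. 0 < t \<and> t < 1 \<and> (a, b) \<in> all_edges V E \<and>
      ((?L a \<and> ?L b) \<or> (?L a \<and> \<not> ?L b) \<and> t < \<epsilon> \<or> (\<not> ?L a \<and> ?L b) \<and> 1 - \<epsilon> < t)}"
    by (auto simp: comp(1) end_nbhd_def Let_def)
  also have "open \<dots>"
    by (intro open_Collect_conj open_Collect_disj open_Collect_const open_Collect_less continuous_intros)
  finally show ?thesis .
next
  case (lim A B s \<epsilon>)
  have "{t. 0 < t \<and> t < 1 \<and> Inner a b t \<in> U} = {t. 0 < t \<and> t < 1 \<and>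
      ((a, b) \<in> all_edges V E \<and> a \<in> A \<and> b \<in> B) \<and> \<bar>t - s\<bar> < \<epsilon>}"
    by (auto simp: lim(1) lim_nbhd_def)
  also have "open \<dots>"
    by (intro open_Collect_conj open_Collect_const open_Collect_less continuous_intros)
  finally show ?thesis .
qed

text \<open>For an end neighbourhood its own \<epsilon> works: if the other endpoint of the edge
  lives in the component too, all inner points of the edge belong to the neighbourhood.\<close>

lemma vertex_in_generator:
  assumes "U \<in> gen_sets V E" "Pt (Vx c) \<in> U"
  shows "\<exists>\<epsilon>>0. \<forall>a b t. (a, b) \<in> all_edges V E \<longrightarrow> 0 < t \<longrightarrow> t < 1 \<longrightarrow>
    (a = Vx c \<and> t < \<epsilon>) \<or> (b = Vx c \<and> 1 - \<epsilon> < t) \<longrightarrow> Inner a b t \<in> U"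
  using assms(1)
proof (cases rule: gen_sets_cases)
  case (star v \<epsilon>)
  then have "v = c" using assms(2) by (simp add: star_set_def)
  then show ?thesis using star(3) unfolding star(1) by (intro exI[of _ \<epsilon>]) (simp add: star_set_def)
next
  case edge
  then show ?thesis using assms(2) by auto
next
  case (comp Y \<omega> \<epsilon>)
  have "lives_in V E Y (Vx c) (comp_of V E Y \<omega>)"
    using assms(2) by (simp add: comp(1) end_nbhd_def Let_def)
  then show ?thesis using comp(5) unfolding comp(1)
    by (intro exI[of _ \<epsilon>]) (auto simp: end_nbhd_def Let_def)
next
  case lim
  then show ?thesis using assms(2) by (simp add: lim_nbhd_def)
qed

context enumerated_digraph
begin

section \<open>Finite approximations of the path\<close>

primrec st :: "nat \<Rightarrow> real \<Rightarrow> 'v cell" where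
  "st 0 x = Blk (e 0) 0 1"
| "st (Suc n) x = (case st n x of Blk c p q \<Rightarrow> locate p q (refine n c) x | Ed u w p q \<Rightarrow> Ed u w p q)"

lemma e_in_V: "e n \<in> V"
  using range_e by blast

lemma refine_subset: "c \<in> V \<Longrightarrow> refine n c \<noteq> [] \<and> set (refine n c) \<subseteq> part n c"
  using refine_props(1)[of c n] unfolding walk_def by blast

lemma st_vertex_in_V: "st n x = Blk c p q \<Longrightarrow> c \<in> V"
proof (induction n arbitrary: c p q)
  case 0
  then show ?case using e_in_V[of 0] by auto
next
  case (Suc n)
  show ?case
  proof (cases "st n x")
    case (Blk c' p' q')
    then have c': "c' \<in> V" by (rule Suc.IH)
    have "c \<in> set (refine n c')"
      using Suc.prems Blk refine_subset[OF c', of n] by (auto intro: locate_Blk_in)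
    then show ?thesis using refine_subset[OF c', of n] part_subset[OF c', of n] by blast
  next
    case Ed
    then show ?thesis using Suc.prems by simp
  qed
qed

lemma locate_refine_tracks:
  assumes "c \<in> V" "p < q"
  shows "tracks E p q c c (locate p q (refine n c))"
  using locate_tracks[OF assms(2), of "refine n c" E] refine_props(1)[OF assms(1), of n]
  by (simp add: walk_def)

lemma st_tracks: "tracks E 0 1 (e 0) (e 0) (st n)"
proof (induction n)
  case 0
  then show ?case by (simp add: tracks_def left_end_def right_end_def)
next
  case (Suc n)
  have "tracks E p q c c (locate p q (refine n c))" if "x \<in> {0..1}" "st n x = Blk c p q" for c p q x
    using locate_refine_tracks st_vertex_in_V[OF that(2)] tracks_Blk(2)[OF Suc that] by blast
  from tracks_refine[OF Suc this] show ?case by simp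
qed

lemma st_Ed_persists: "n \<le> m \<Longrightarrow> st n x = Ed u w p q \<Longrightarrow> st m x = Ed u w p q"
  by (induction m rule: dec_induct) simp_all

text \<open>Walks inserted at stage m stay in a class of the m-th partition, and the partitions are
  nested, so later cells at time x involve only vertices of \<open>part n c\<close>.\<close>

lemma st_part:
  assumes "n \<le> m" "st n x = Blk c p q"
  shows "(\<forall>c' p' q'. st m x = Blk c' p' q' \<longrightarrow> c' \<in> part n c) \<and>
    (\<forall>u w p' q'. st m x = Ed u w p' q' \<longrightarrow> u \<in> part n c \<and> w \<in> part n c)"
  using assms(1)
proof (induction m rule: dec_induct)
  case base
  then show ?case using assms(2) part_self[OF st_vertex_in_V[OF assms(2)]] by simp
next
  case (step m)
  show ?case
  proof (cases "st m x")
    case (Ed u w p q)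
    then show ?thesis using step.IH by simp
  next
    case (Blk c1 p1 q1)
    have c1: "c1 \<in> V" using st_vertex_in_V[OF Blk] .
    have "part n c1 = part n c"
      using step.IH Blk part_eq[OF st_vertex_in_V[OF assms(2)]] by blast
    then have sub: "set (refine m c1) \<subseteq> part n c"
      using refine_subset[OF c1, of m] part_antimono[OF step.hyps(1) c1] by blast
    have "st (Suc m) x = locate p1 q1 (refine m c1) x" using Blk by simp
    then show ?thesis
      using sub locate_Blk_in[of "refine m c1" p1 q1 x] locate_Ed_in[of p1 q1 "refine m c1" x]
        refine_subset[OF c1, of m] by auto
  qed
qed

text \<open>Later cells stay in the class {c}, and an edge cell there would be a loop.\<close>

lemma st_vertex_persists:
  assumes "n \<le> m" "x \<in> {0..1}" "st n x = Blk c p q" "c \<in> X n"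
  shows "\<exists>p' q'. st m x = Blk c p' q'"
proof (cases "st m x")
  case (Blk c' p' q')
  then show ?thesis using st_part[OF assms(1,3)] part_X[OF assms(4)] by auto
next
  case (Ed u w p' q')
  then have "u = c \<and> w = c" using st_part[OF assms(1,3)] part_X[OF assms(4)] by auto
  moreover have "(u, w) \<in> E" using tracks_Ed(1)[OF st_tracks assms(2) Ed] .
  ultimately show ?thesis using digraph by (simp add: digraph_def)
qed

text \<open>The closed walks inserted at \<open>c\<close> start and end at \<open>c\<close>.\<close>
lemma st_boundary_persists:
  assumes "n \<le> m" "x \<in> {0..1}" "st n x = Blk c p q" "x = p \<or> x = q"
  shows "\<exists>p' q'. st m x = Blk c p' q' \<and> (x = p' \<or> x = q')"
  using assms(1)
proof (induction m rule: dec_induct)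
  case base
  then show ?case using assms by blast
next
  case (step m)
  then obtain p' q' where m: "st m x = Blk c p' q'" "x = p' \<or> x = q'" by blast
  have "p' < q'" using tracks_Blk(2)[OF st_tracks assms(2) m(1)] .
  then have *: "tracks E p' q' c c (locate p' q' (refine m c))"
    using locate_refine_tracks st_vertex_in_V[OF m(1)] by blast
  show ?case using m tracks_start[OF *] tracks_finish[OF *] \<open>p' < q'\<close> by auto
qed

text \<open>Quantifying over all stages builds their agreement into the predicate; the existence
  proof has to establish it, and afterwards the value at x can be read off at any stage. The clause
  for ends also stores the component information that continuity needs.\<close>

definition is_point :: "real \<Rightarrow> 'v point \<Rightarrow> bool" where
  "is_point x z \<longleftrightarrow>
     (\<forall>n u w p q. st n x = Ed u w p q \<longrightarrow> z = Inner (Vx u) (Vx w) ((x - p) / (q - p))) \<and>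
     (\<forall>n c p q. st n x = Blk c p q \<longrightarrow> c \<in> X n \<longrightarrow> z = Pt (Vx c)) \<and>
     ((\<forall>n. \<exists>c p q. st n x = Blk c p q \<and> c \<notin> X n) \<longrightarrow>
       (\<exists>\<omega>\<in>ends V E. z = Pt (En \<omega>) \<and>
         (\<forall>n c p q Y. st n x = Blk c p q \<longrightarrow> Y \<subseteq> X n \<longrightarrow> part n c \<subseteq> comp_of V E Y \<omega>)))"

lemma st_cases:
  obtains (Ed) n u w p q where "st n x = Ed u w p q"
    | (vertex) n c p q where "st n x = Blk c p q" "c \<in> X n"
    | (limit) "\<And>n. \<exists>c p q. st n x = Blk c p q \<and> c \<notin> X n"
proof (cases "\<exists>n u w p q. st n x = Ed u w p q")
  case True
  then show ?thesis using Ed by blast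
next
  case False
  have blk: "\<exists>c p q. st n x = Blk c p q" for n
    using False by (cases "st n x") auto
  show ?thesis
  proof (cases "\<exists>n c p q. st n x = Blk c p q \<and> c \<in> X n")
    case True
    then show ?thesis using vertex by blast
  next
    case False
    show ?thesis
    proof (rule limit)
      fix n
      obtain c p q where "st n x = Blk c p q" using blk[of n] by blast
      then show "\<exists>c p q. st n x = Blk c p q \<and> c \<notin> X n" using False by blast
    qed
  qed
qed

lemma is_point_exists:
  assumes x: "x \<in> {0..1}"
  shows "\<exists>z. is_point x z"
proof (cases rule: st_cases[of x])
  case (Ed n u w p q)
  \<comment> \<open>Stages n and m are compared at their maximum, up to which edge cells and settled
    vertices persist.\<close>
  have later: "st (max n m) x = Ed u w p q" for m using Ed by (rule st_Ed_persists[of n, rotated]) simp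
  have "is_point x (Inner (Vx u) (Vx w) ((x - p) / (q - p)))"
    unfolding is_point_def
  proof (intro conjI allI impI)
    fix m u' w' p' q' assume *: "st m x = Ed u' w' p' q'"
    show "Inner (Vx u) (Vx w) ((x - p) / (q - p)) = Inner (Vx u') (Vx w') ((x - p') / (q' - p'))"
      using st_Ed_persists[OF max.cobounded2 *, of n] later[of m] by simp
  next
    fix m c p' q' assume "st m x = Blk c p' q'" "c \<in> X m"
    from st_vertex_persists[OF max.cobounded2 x this, of n]
    show "Inner (Vx u) (Vx w) ((x - p) / (q - p)) = Pt (Vx c)" using later[of m] by simp
  next
    assume "\<forall>n. \<exists>c p q. st n x = Blk c p q \<and> c \<notin> X n"
    from spec[OF this, of n] Ed show "\<exists>\<omega>\<in>ends V E. Inner (Vx u) (Vx w) ((x - p) / (q - p)) = Pt (En \<omega>) \<and>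
      (\<forall>n c p q Y. st n x = Blk c p q \<longrightarrow> Y \<subseteq> X n \<longrightarrow> part n c \<subseteq> comp_of V E Y \<omega>)" by simp
  qed
  then show ?thesis ..
next
  case (vertex n c p q)
  have later: "\<exists>p' q'. st (max n m) x = Blk c p' q'" for m
    using vertex by (rule st_vertex_persists[OF max.cobounded1 x])
  have "is_point x (Pt (Vx c))"
    unfolding is_point_def
  proof (intro conjI allI impI)
    fix m u w p' q' assume "st m x = Ed u w p' q'"
    from st_Ed_persists[OF max.cobounded2 this, of n]
    show "Pt (Vx c) = Inner (Vx u) (Vx w) ((x - p') / (q' - p'))" using later[of m] by simp
  next
    fix m c' p' q' assume "st m x = Blk c' p' q'" "c' \<in> X m"
    from st_vertex_persists[OF max.cobounded2 x this, of n]
    show "Pt (Vx c) = Pt (Vx c')" using later[of m] by auto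
  next
    assume "\<forall>n. \<exists>c p q. st n x = Blk c p q \<and> c \<notin> X n"
    from spec[OF this, of n] vertex show "\<exists>\<omega>\<in>ends V E. Pt (Vx c) = Pt (En \<omega>) \<and>
      (\<forall>n c p q Y. st n x = Blk c p q \<longrightarrow> Y \<subseteq> X n \<longrightarrow> part n c \<subseteq> comp_of V E Y \<omega>)" by simp
  qed
  then show ?thesis ..
next
  case limit
  define c where "c n = (SOME c. \<exists>p q. st n x = Blk c p q \<and> c \<notin> X n)" for n
  have c: "\<exists>p q. st n x = Blk (c n) p q \<and> c n \<notin> X n" for n
    unfolding c_def using limit[of n] by (rule someI_ex)
  have "c n \<in> V" for n using c[of n] st_vertex_in_V by blast
  moreover have "c n \<notin> X n" for n using c[of n] by blast
  moreover have "c (Suc n) \<in> part n (c n)" for n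
  proof -
    obtain p q p' q' where n: "st n x = Blk (c n) p q" and S: "st (Suc n) x = Blk (c (Suc n)) p' q'"
      using c[of n] c[of "Suc n"] by blast
    have "n \<le> Suc n" by simp
    from conjunct1[OF st_part[OF this n]] S show ?thesis by (elim allE) (rule mp)
  qed
  ultimately have "\<exists>\<omega>\<in>ends V E. \<forall>n. \<forall>Y\<subseteq>X n. part n (c n) \<subseteq> comp_of V E Y \<omega>" by (rule end_exists)
  then obtain \<omega> where \<omega>: "\<omega> \<in> ends V E" "\<forall>n. \<forall>Y\<subseteq>X n. part n (c n) \<subseteq> comp_of V E Y \<omega>" ..
  have "is_point x (Pt (En \<omega>))"
    unfolding is_point_def
  proof (intro conjI allI impI bexI[OF _ \<omega>(1)])
    fix m u w p' q' assume "st m x = Ed u w p' q'"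
    then show "Pt (En \<omega>) = Inner (Vx u) (Vx w) ((x - p') / (q' - p'))" using c[of m] by simp
  next
    fix m c' p' q' assume "st m x = Blk c' p' q'" "c' \<in> X m"
    then show "Pt (En \<omega>) = Pt (Vx c')" using c[of m] by simp
  next
    fix m c' p' q' Y assume "st m x = Blk c' p' q'" "Y \<subseteq> X m"
    then show "part m c' \<subseteq> comp_of V E Y \<omega>" using c[of m] \<omega>(2) by simp
  qed simp
  then show ?thesis ..
qed

definition path :: "real \<Rightarrow> 'v point" where
  "path x = (SOME z. is_point x z)"

lemma is_point_path: "x \<in> {0..1} \<Longrightarrow> is_point x (path x)"
  unfolding path_def using is_point_exists by (rule someI_ex)

lemma path_Ed:
  assumes "x \<in> {0..1}" "st n x = Ed u w p q"
  shows "path x = Inner (Vx u) (Vx w) ((x - p) / (q - p))"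
  using conjunct1[OF is_point_path[OF assms(1), unfolded is_point_def]] assms(2)
  by (elim allE) (rule mp)

lemma path_vertex:
  assumes "x \<in> {0..1}" "st n x = Blk c p q" "c \<in> X n"
  shows "path x = Pt (Vx c)"
  using conjunct1[OF conjunct2[OF is_point_path[OF assms(1), unfolded is_point_def]]] assms(2,3)
  by (elim allE) (drule (1) mp)+

lemma path_end:
  assumes "x \<in> {0..1}" "\<And>n. \<exists>c p q. st n x = Blk c p q \<and> c \<notin> X n"
  shows "\<exists>\<omega>\<in>ends V E. path x = Pt (En \<omega>) \<and>
         (\<forall>n c p q Y. st n x = Blk c p q \<longrightarrow> Y \<subseteq> X n \<longrightarrow> part n c \<subseteq> comp_of V E Y \<omega>)"
  by (rule mp[OF conjunct2[OF conjunct2[OF is_point_path[OF assms(1), unfolded is_point_def]]]])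
    (rule allI, rule assms(2))

text \<open>A boundary time keeps its vertex c under all refinements, and c belongs to X from some
  stage on, which settles the value.\<close>

lemma path_boundary:
  assumes "x \<in> {0..1}" "st n x = Blk c p q" "x = p \<or> x = q"
  shows "path x = Pt (Vx c)"
proof -
  obtain m where "c \<in> X m" using vertex_in_X st_vertex_in_V[OF assms(2)] by blast
  then have "c \<in> X (max n m)" using X_mono[of m "max n m"] by auto
  moreover obtain p' q' where "st (max n m) x = Blk c p' q'"
    using st_boundary_persists[OF _ assms, of "max n m"] by auto
  ultimately show ?thesis using path_vertex[OF assms(1)] by blast
qed

lemma edge_in_all_edges: "(u, w) \<in> E \<Longrightarrow> (Vx u, Vx w) \<in> all_edges V E"
  by (simp add: all_edges_def)

text \<open>From stage n on, time x sees only \<open>part n c\<close>, which lies in the component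
  of \<omega>. An edge found there has both endpoints in the component, so its inner points qualify
  for every \<epsilon>; an end found there lives in the same component because the two components
  share c.\<close>

lemma path_in_end_nbhd:
  assumes x: "x \<in> {0..1}" and st: "st n x = Blk c p q" and Y: "Y \<subseteq> X n"
    and \<omega>: "\<omega> \<in> ends V E" "part n c \<subseteq> comp_of V E Y \<omega>"
  shows "path x \<in> end_nbhd V E Y \<omega> \<epsilon>"
proof -
  let ?C = "comp_of V E Y \<omega>"
  show ?thesis
  proof (cases rule: st_cases[of x])
    case (Ed m u w p' q')
    \<comment> \<open>Edge cells persist, so none can appear before stage n, where x is still in a
      block.\<close>
    have "n \<le> m" using st_Ed_persists[OF _ Ed, of n] st by (cases "n \<le> m") auto
    then have "u \<in> ?C" "w \<in> ?C" using st_part[OF _ st] Ed \<omega>(2) by blast+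
    moreover note tracks_Ed[OF st_tracks x Ed]
    ultimately show ?thesis unfolding path_Ed[OF x Ed]
      by (auto simp: end_nbhd_def Let_def lives_in_def edge_in_all_edges)
  next
    case (vertex m c' p' q')
    have "\<exists>p' q'. st (max n m) x = Blk c' p' q'" using st_vertex_persists[OF _ x vertex, of "max n m"] by simp
    then have "c' \<in> part n c" using st_part[OF _ st, of "max n m"] by auto
    then show ?thesis unfolding path_vertex[OF x vertex] using \<omega>(2)
      by (auto simp: end_nbhd_def Let_def lives_in_def)
  next
    case limit
    obtain \<eta> where \<eta>: "\<eta> \<in> ends V E" "path x = Pt (En \<eta>)"
      and "\<forall>n c p q Y. st n x = Blk c p q \<longrightarrow> Y \<subseteq> X n \<longrightarrow> part n c \<subseteq> comp_of V E Y \<eta>"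
      using path_end[OF x limit] by (elim bexE conjE)
    then have sub: "part n c \<subseteq> comp_of V E Y \<eta>" using st Y by simp
    have Y': "finite Y" "Y \<subseteq> V" using Y X_subset[of n] finite_subset[OF Y] by auto
    have "c \<in> part n c" using part_self st_vertex_in_V[OF st] by blast
    then have "comp_of V E Y \<eta> = ?C"
      using strong_component_disjoint[OF comp_of_strong_component[OF \<eta>(1) Y']
          comp_of_strong_component[OF \<omega>(1) Y'], of c] sub \<omega>(2) by blast
    then show ?thesis unfolding \<eta>(2) using \<eta>(1) by (auto simp: end_nbhd_def Let_def lives_in_def)
  qed
qed

section \<open>Local behaviour of the path and continuity\<close>

lemma path_Ed_on:
  assumes "x \<in> {0..1}" "st n x = Ed u w p q" "y \<in> {p<..<q}"
  shows "path y = Inner (Vx u) (Vx w) ((y - p) / (q - p))" "0 < (y - p) / (q - p)" "(y - p) / (q - p) < 1"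
proof -
  note * = tracks_Ed[OF st_tracks assms(1,2)]
  have "y \<in> {0..1}" using *(2,5) assms(3) by auto
  then show "path y = Inner (Vx u) (Vx w) ((y - p) / (q - p))"
    using *(6)[OF assms(3)] by (rule path_Ed)
  show "0 < (y - p) / (q - p)" "(y - p) / (q - p) < 1" using assms(3) by auto
qed

lemma path_Ed_boundary:
  assumes "x \<in> {0..1}" "st n x = Ed u w p q"
  shows "path p = Pt (Vx u)" "path q = Pt (Vx w)"
proof -
  note * = tracks_Ed[OF st_tracks assms]
  have "p \<in> {0..1}" "q \<in> {0..1}" using *(2-5) by auto
  then show "path p = Pt (Vx u)" "path q = Pt (Vx w)" using path_boundary *(7,8) by blast+
qed

text \<open>Just before x there is more of the block, where the path rests at c, or the start of
  time, or an edge entering c.\<close>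

lemma path_left_of_vertex:
  assumes x: "x \<in> {0..1}" and st: "st n x = Blk c p q" "c \<in> X n"
    and U: "U \<in> gen_sets V E" "Pt (Vx c) \<in> U"
  shows "\<exists>\<delta>>0. \<forall>y\<in>{0..1}. x - \<delta> < y \<and> y \<le> x \<longrightarrow> path y \<in> U"
proof -
  note * = tracks_Blk[OF st_tracks x st(1)]
  have blk: "path y \<in> U" if "y \<in> {p..q}" for y
    using path_vertex[OF _ *(6)[OF that] st(2)] that *(1,3) U(2) by auto
  have "p < x \<or> x = p \<and> p = 0 \<or> x = p \<and> (\<exists>d p0. 0 \<le> p0 \<and> p0 < p \<and> (\<forall>y\<in>{p0<..<p}. st n y = Ed d c p0 p))"
    using *(4,7) unfolding left_end_def by (cases "x = p") auto
  then show ?thesis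
  proof (elim disjE conjE exE)
    assume "p < x"
    then show ?thesis using blk *(5) by (intro exI[of _ "x - p"]) auto
  next
    assume "x = p" "p = 0"
    then show ?thesis using blk *(5) by (intro exI[of _ 1]) auto
  next
    fix d p0 assume xp: "x = p" and p0: "0 \<le> p0" "p0 < p" and ed: "\<forall>y\<in>{p0<..<p}. st n y = Ed d c p0 p"
    obtain \<epsilon> where \<epsilon>: "0 < \<epsilon>" "\<forall>a b t. (a, b) \<in> all_edges V E \<longrightarrow> 0 < t \<longrightarrow> t < 1 \<longrightarrow>
        (a = Vx c \<and> t < \<epsilon>) \<or> (b = Vx c \<and> 1 - \<epsilon> < t) \<longrightarrow> Inner a b t \<in> U"
      using vertex_in_generator[OF U] by blast
    \<comment> \<open>The first bound keeps y inside the time interval of the edge, the second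
      inside its last \<epsilon>-fraction, where the edge parameter exceeds 1 - \<epsilon>.\<close>
    define \<delta> where "\<delta> = min (p - p0) (\<epsilon> * (p - p0))"
    have "path y \<in> U" if y: "y \<in> {0..1}" "x - \<delta> < y" "y \<le> x" for y
    proof (cases "y = p")
      case True
      then show ?thesis using blk *(2) by simp
    next
      case False
      then have yin: "y \<in> {p0<..<p}" using y xp unfolding \<delta>_def by auto
      then have sty: "st n y = Ed d c p0 p" using ed by blast
      have "p - y < \<epsilon> * (p - p0)" using y xp unfolding \<delta>_def by auto
      then have "1 - \<epsilon> < (y - p0) / (p - p0)" using p0(2) by (simp add: field_simps)
      then show ?thesis
        using \<epsilon>(2) path_Ed_on[OF y(1) sty yin] edge_in_all_edges[OF tracks_Ed(1)[OF st_tracks y(1) sty]]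
        by simp
    qed
    moreover have "0 < \<delta>" using \<epsilon>(1) p0(2) by (simp add: \<delta>_def)
    ultimately show ?thesis by blast
  qed
qed

lemma path_right_of_vertex:
  assumes x: "x \<in> {0..1}" and st: "st n x = Blk c p q" "c \<in> X n"
    and U: "U \<in> gen_sets V E" "Pt (Vx c) \<in> U"
  shows "\<exists>\<delta>>0. \<forall>y\<in>{0..1}. x \<le> y \<and> y < x + \<delta> \<longrightarrow> path y \<in> U"
proof -
  note * = tracks_Blk[OF st_tracks x st(1)]
  have blk: "path y \<in> U" if "y \<in> {p..q}" for y
    using path_vertex[OF _ *(6)[OF that] st(2)] that *(1,3) U(2) by auto
  have "x < q \<or> x = q \<and> q = 1 \<or> x = q \<and> (\<exists>d q0. q < q0 \<and> q0 \<le> 1 \<and> (\<forall>y\<in>{q<..<q0}. st n y = Ed c d q q0))"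
    using *(5,8) unfolding right_end_def by (cases "x = q") auto
  then show ?thesis
  proof (elim disjE conjE exE)
    assume "x < q"
    then show ?thesis using blk *(4) by (intro exI[of _ "q - x"]) auto
  next
    assume "x = q" "q = 1"
    then show ?thesis using blk *(4) by (intro exI[of _ 1]) auto
  next
    fix d q0 assume xq: "x = q" and q0: "q < q0" "q0 \<le> 1" and ed: "\<forall>y\<in>{q<..<q0}. st n y = Ed c d q q0"
    obtain \<epsilon> where \<epsilon>: "0 < \<epsilon>" "\<forall>a b t. (a, b) \<in> all_edges V E \<longrightarrow> 0 < t \<longrightarrow> t < 1 \<longrightarrow>
        (a = Vx c \<and> t < \<epsilon>) \<or> (b = Vx c \<and> 1 - \<epsilon> < t) \<longrightarrow> Inner a b t \<in> U"
      using vertex_in_generator[OF U] by blast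
    define \<delta> where "\<delta> = min (q0 - q) (\<epsilon> * (q0 - q))"
    have "path y \<in> U" if y: "y \<in> {0..1}" "x \<le> y" "y < x + \<delta>" for y
    proof (cases "y = q")
      case True
      then show ?thesis using blk *(2) by simp
    next
      case False
      then have yin: "y \<in> {q<..<q0}" using y xq unfolding \<delta>_def by auto
      then have sty: "st n y = Ed c d q q0" using ed by blast
      have "y - q < \<epsilon> * (q0 - q)" using y xq unfolding \<delta>_def by auto
      then have "(y - q) / (q0 - q) < \<epsilon>" using q0(1) by (simp add: field_simps)
      then show ?thesis
        using \<epsilon>(2) path_Ed_on[OF y(1) sty yin] edge_in_all_edges[OF tracks_Ed(1)[OF st_tracks y(1) sty]]
        by simp
    qed
    moreover have "0 < \<delta>" using \<epsilon>(1) q0(1) by (simp add: \<delta>_def)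
    ultimately show ?thesis by blast
  qed
qed

text \<open>At an end only generators of the form \<open>end_nbhd\<close> matter, as the others
  contain no ends. If Y is the finite set of such a generator, any stage n with Y \<subseteq> X n
  has its whole block around x mapped into it.\<close>

lemma path_locally_in_generator:
  assumes x: "x \<in> {0..1}" and U: "U \<in> gen_sets V E" "path x \<in> U"
  shows "\<exists>\<delta>>0. \<forall>y\<in>{0..1}. \<bar>y - x\<bar> < \<delta> \<longrightarrow> path y \<in> U"
proof (cases rule: st_cases[of x])
  case (Ed n u w p q)
  have xin: "x \<in> {p<..<q}" using tracks_Ed(3,4)[OF st_tracks x Ed] by simp
  define S where "S = {t. 0 < t \<and> t < 1 \<and> Inner (Vx u) (Vx w) t \<in> U}"
  have "open S" unfolding S_def by (rule open_inner_slice[OF U(1)])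
  moreover have "continuous_on UNIV (\<lambda>y. (y - p) / (q - p))" using xin by (intro continuous_intros) auto
  ultimately have "open ({p<..<q} \<inter> (\<lambda>y. (y - p) / (q - p)) -` S)" by (intro open_Int open_vimage) auto
  moreover have "x \<in> {p<..<q} \<inter> (\<lambda>y. (y - p) / (q - p)) -` S"
    using xin U(2) path_Ed_on[OF x Ed xin] by (simp add: S_def)
  ultimately obtain \<delta> where \<delta>: "0 < \<delta>" "ball x \<delta> \<subseteq> {p<..<q} \<inter> (\<lambda>y. (y - p) / (q - p)) -` S"
    by (meson open_contains_ball)
  have "path y \<in> U" if "\<bar>y - x\<bar> < \<delta>" for y
  proof -
    have "y \<in> ball x \<delta>" using that by (simp add: dist_real_def abs_minus_commute)
    then have "y \<in> {p<..<q}" "(y - p) / (q - p) \<in> S" using \<delta>(2) by auto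
    then show ?thesis using path_Ed_on(1)[OF x Ed] by (simp add: S_def)
  qed
  then show ?thesis using \<delta>(1) by blast
next
  case (vertex n c p q)
  have "Pt (Vx c) \<in> U" using path_vertex[OF x vertex] U(2) by simp
  then obtain \<delta>1 \<delta>2 where "0 < \<delta>1" "\<forall>y\<in>{0..1}. x - \<delta>1 < y \<and> y \<le> x \<longrightarrow> path y \<in> U"
    "0 < \<delta>2" "\<forall>y\<in>{0..1}. x \<le> y \<and> y < x + \<delta>2 \<longrightarrow> path y \<in> U"
    using path_left_of_vertex[OF x vertex U(1)] path_right_of_vertex[OF x vertex U(1)] by blast
  then show ?thesis by (intro exI[of _ "min \<delta>1 \<delta>2"]) (force simp: abs_less_iff)
next
  case limit
  obtain \<omega> where \<omega>: "\<omega> \<in> ends V E" "path x = Pt (En \<omega>)"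
    and sub: "\<forall>n c p q Y. st n x = Blk c p q \<longrightarrow> Y \<subseteq> X n \<longrightarrow> part n c \<subseteq> comp_of V E Y \<omega>"
    using path_end[OF x limit] by (elim bexE conjE)
  from U(1) show ?thesis
  proof (cases rule: gen_sets_cases)
    case (comp Y \<eta> \<epsilon>)
    have eq: "comp_of V E Y \<omega> = comp_of V E Y \<eta>"
      using U(2) \<omega>(2) by (simp add: comp(1) end_nbhd_def Let_def lives_in_def)
    obtain n where n: "Y \<subseteq> X n" using finite_subset_X comp(3,4) by blast
    obtain c p q where st: "st n x = Blk c p q" using limit[of n] by blast
    note * = tracks_Blk[OF st_tracks x st]
    have "part n c \<subseteq> comp_of V E Y \<eta>" using sub st n eq by blast
    then have "path y \<in> U" if "y \<in> {p..q}" for y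
      unfolding comp(1) using path_in_end_nbhd[OF _ *(6)[OF that] n comp(2)] that *(1,3) by auto
    then have "\<forall>y\<in>{0..1}. \<bar>y - x\<bar> < min (x - p) (q - x) \<longrightarrow> path y \<in> U"
      by (auto simp: abs_less_iff)
    \<comment> \<open>Boundary times are mapped to vertices, so a time mapped to an end has room on
      both sides within its block.\<close>
    moreover have "x \<noteq> p \<and> x \<noteq> q" using path_boundary[OF x st] \<omega>(2) by auto
    ultimately show ?thesis using *(4,5) by (intro exI[of _ "min (x - p) (q - x)"]) simp
  qed (use U(2) \<omega>(2) in \<open>auto simp: star_set_def lim_nbhd_def\<close>)
qed

lemma path_in_topspace:
  assumes x: "x \<in> {0..1}"
  shows "path x \<in> topspace (DTop V E)"
proof (cases rule: st_cases[of x])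
  case (Ed n u w p q)
  note * = tracks_Ed[OF st_tracks x Ed]
  have "{Inner (Vx u) (Vx w) t | t. 0 < t \<and> t < 1} \<in> gen_sets V E" using *(1) by (intro edge_generator) auto
  moreover have "path x \<in> {Inner (Vx u) (Vx w) t | t. 0 < t \<and> t < 1}" using path_Ed_on[OF x Ed, of x] *(3,4) by auto
  ultimately show ?thesis unfolding topspace_DTop by blast
next
  case (vertex n c p q)
  have "star_set V E c 1 \<in> gen_sets V E" using st_vertex_in_V[OF vertex(1)] by (simp add: star_set_generator)
  moreover have "path x \<in> star_set V E c 1" unfolding path_vertex[OF x vertex] by (simp add: star_set_def)
  ultimately show ?thesis unfolding topspace_DTop by blast
next
  case limit
  then obtain \<omega> where \<omega>: "\<omega> \<in> ends V E" "path x = Pt (En \<omega>)" using path_end[OF x] by blast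
  have "end_nbhd V E {} \<omega> 1 \<in> gen_sets V E" using \<omega>(1) by (simp add: end_nbhd_generator)
  moreover have "path x \<in> end_nbhd V E {} \<omega> 1" unfolding \<omega>(2) using \<omega>(1) by (simp add: end_nbhd_def Let_def lives_in_def)
  ultimately show ?thesis unfolding topspace_DTop by blast
qed

lemma continuous_path: "continuous_map (top_of_set {0..1}) (DTop V E) path"
  unfolding DTop_def
proof (rule continuous_on_generated_topo)
  fix U assume U: "U \<in> gen_sets V E"
  show "openin (top_of_set {0..1}) (path -` U \<inter> topspace (top_of_set {0..1}))"
    unfolding openin_euclidean_subtopology_iff
  proof (intro conjI ballI)
    fix x assume "x \<in> path -` U \<inter> topspace (top_of_set {0..1})"
    then obtain \<delta> where "0 < \<delta>" "\<forall>y\<in>{0..1}. \<bar>y - x\<bar> < \<delta> \<longrightarrow> path y \<in> U"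
      using path_locally_in_generator[OF _ U, of x] by auto
    then show "\<exists>\<delta>>0. \<forall>y\<in>{0..1}. dist y x < \<delta> \<longrightarrow> y \<in> path -` U \<inter> topspace (top_of_set {0..1})"
      by (intro exI[of _ \<delta>]) (simp add: dist_real_def)
  qed simp
next
  show "path ` topspace (top_of_set {0..1}) \<subseteq> \<Union> (gen_sets V E)"
    using path_in_topspace unfolding topspace_DTop by auto
qed

text \<open>The inverse sends the inner point with parameter s to the time p + s * (q - p). The path
  is open here because open subintervals of an edge of D are generators.\<close>

lemma path_homeomorphic_edge:
  assumes x: "x \<in> {0..1}" and Ed: "st n x = Ed u w p q"
  shows "homeomorphic_map (top_of_set {p<..<q}) (subtopology (DTop V E) (edge_interior (Vx u) (Vx w))) path"
proof (rule bijective_open_imp_homeomorphic_map)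
  note * = tracks_Ed[OF st_tracks x Ed]
  note path = path_Ed_on[OF x Ed]
  let ?I = "edge_interior (Vx u) (Vx w)"
  have sub: "{p<..<q} \<subseteq> {0..1}" using *(2,5) by auto
  have "?I \<in> gen_sets V E" unfolding edge_interior_def using *(1) by (intro edge_generator) auto
  then have top: "topspace (subtopology (DTop V E) ?I) = ?I" unfolding topspace_subtopology topspace_DTop by blast
  have inv: "path (p + s * (q - p)) = Inner (Vx u) (Vx w) s \<and> p + s * (q - p) \<in> {p<..<q}"
    if "0 < s" "s < 1" for s
  proof -
    have "0 < s * (q - p)" "s * (q - p) < 1 * (q - p)" using that *(3,4) by (auto intro: mult_strict_right_mono)
    then have "p + s * (q - p) \<in> {p<..<q}" by simp
    then show ?thesis using path(1)[of "p + s * (q - p)"] *(3,4) by simp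
  qed
  have into: "path ` {p<..<q} \<subseteq> ?I" using path by (auto simp: edge_interior_def)
  moreover have "?I \<subseteq> path ` {p<..<q}"
  proof
    fix z assume "z \<in> ?I"
    then obtain s where "0 < s" "s < 1" "z = Inner (Vx u) (Vx w) s" by (auto simp: edge_interior_def)
    then show "z \<in> path ` {p<..<q}" using inv[of s] by (metis imageI)
  qed
  ultimately show "path ` topspace (top_of_set {p<..<q}) = topspace (subtopology (DTop V E) ?I)"
    unfolding top by simp
  have "continuous_map (top_of_set {p<..<q}) (DTop V E) path"
    using continuous_map_from_subtopology[OF continuous_path, of "{p<..<q}"] sub
    by (simp add: subtopology_subtopology inf.absorb2)
  then show "continuous_map (top_of_set {p<..<q}) (subtopology (DTop V E) ?I) path"
    using into by (auto simp: continuous_map_in_subtopology)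
  show "inj_on path (topspace (top_of_set {p<..<q}))"
  proof (rule inj_onI)
    fix y y' assume "y \<in> topspace (top_of_set {p<..<q})" "y' \<in> topspace (top_of_set {p<..<q})" "path y = path y'"
    then show "y = y'" using path(1)[of y] path(1)[of y'] by simp
  qed
  show "open_map (top_of_set {p<..<q}) (subtopology (DTop V E) ?I) path"
    unfolding open_map_def
  proof (intro allI impI)
    fix T assume "openin (top_of_set {p<..<q}) T"
    then have T: "open T" "T \<subseteq> {p<..<q}" by (auto simp: openin_open_eq)
    show "openin (subtopology (DTop V E) ?I) (path ` T)"
    proof (subst openin_subopen, intro ballI)
      fix z assume "z \<in> path ` T"
      then obtain y where y: "y \<in> T" "z = path y" by blast
      then obtain \<delta> where \<delta>: "0 < \<delta>" "cball y \<delta> \<subseteq> T" using T(1) open_contains_cball by blast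
      define G where "G = {Inner (Vx u) (Vx w) s | s. (y - \<delta> - p) / (q - p) < s \<and> s < (y + \<delta> - p) / (q - p)}"
      have "y - \<delta> \<in> cball y \<delta>" "y + \<delta> \<in> cball y \<delta>" using \<delta>(1) by (auto simp: dist_real_def)
      then have "y - \<delta> \<in> {p<..<q}" "y + \<delta> \<in> {p<..<q}" using \<delta>(2) T(2) by blast+
      then have in_pq: "p < y - \<delta>" "y + \<delta> < q" by simp_all
      have G: "G \<in> gen_sets V E"
        unfolding G_def using *(1) in_pq \<delta>(1) by (intro edge_generator divide_strict_right_mono) auto
      have "z \<in> G" unfolding G_def y(2) using path(1)[of y] in_pq \<delta>(1)
        by (auto intro!: divide_strict_right_mono)
      moreover have GT: "G \<subseteq> path ` T"
      proof
        fix z' assume "z' \<in> G"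
        then obtain s where s: "z' = Inner (Vx u) (Vx w) s"
          "(y - \<delta> - p) / (q - p) < s" "s < (y + \<delta> - p) / (q - p)" unfolding G_def by blast
        have sy: "y - \<delta> < p + s * (q - p)" "p + s * (q - p) < y + \<delta>"
          using s(2,3) in_pq \<delta>(1) by (auto simp: field_simps)
        have "0 < (y - \<delta> - p) / (q - p)" "(y + \<delta> - p) / (q - p) < 1" using in_pq \<delta>(1) by auto
        then have "z' = path (p + s * (q - p))" using inv[of s] s by simp
        moreover have "p + s * (q - p) \<in> cball y \<delta>" using sy by (auto simp: dist_real_def)
        ultimately show "z' \<in> path ` T" using \<delta>(2) by blast
      qed
      moreover have "openin (subtopology (DTop V E) ?I) G"
      proof -
        have "G \<subseteq> ?I" using GT T(2) into by blast
        then have "G = G \<inter> ?I" by blast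
        then show ?thesis using openin_DTop[OF G] openin_subtopology by metis
      qed
      ultimately show "\<exists>W. openin (subtopology (DTop V E) ?I) W \<and> z \<in> W \<and> W \<subseteq> path ` T" by blast
    qed
  qed
qed

text \<open>The order condition concerns every (c,d) mapped homeomorphically onto the interior of
  the edge. As p and q are sent to vertices, [c,d] lies in [p,q], where the path is the affine
  parametrisation of the edge.\<close>

lemma dtop_path_path: "dtop_path V E path"
  unfolding dtop_path_def
proof (intro conjI continuous_path ballI allI impI)
  fix x a b t assume x01: "x \<in> {0<..<1::real}"
    and ab: "(a, b) \<in> all_edges V E \<and> 0 < t \<and> t < 1 \<and> path x = Inner a b t"
  have x: "x \<in> {0..1}" using x01 by simp
  obtain n u w p q where Ed: "st n x = Ed u w p q"
  proof (cases rule: st_cases[of x])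
    case (vertex n c p q)
    then show ?thesis using path_vertex[OF x vertex] ab by simp
  next
    case limit
    then show ?thesis using path_end[OF x limit] ab by auto
  qed
  note * = tracks_Ed[OF st_tracks x Ed]
  have eq: "a = Vx u" "b = Vx w" using path_Ed[OF x Ed] ab by auto
  show "\<exists>c d. homeo_nbhd V E path x a b c d"
    using path_homeomorphic_edge[OF x Ed] *(2-5) unfolding homeo_nbhd_def eq
    by (intro exI[of _ p] exI[of _ q]) simp
  fix c d assume "homeo_nbhd V E path x a b c d"
  then have cd: "c < x" "x < d"
    and hom: "homeomorphic_map (top_of_set {c<..<d}) (subtopology (DTop V E) (edge_interior a b)) path"
    unfolding homeo_nbhd_def by auto
  have "path ` {c<..<d} \<subseteq> edge_interior a b"
    using homeomorphic_imp_surjective_map[OF hom] by auto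
  then have no_vertex: "path y \<noteq> Pt (Vx v)" if "y \<in> {c<..<d}" for y v
  proof -
    have "path y \<in> edge_interior a b" using \<open>path ` {c<..<d} \<subseteq> edge_interior a b\<close> that by blast
    then show ?thesis by (auto simp: edge_interior_def)
  qed
  \<comment> \<open>If c < p, then p would be a time in (c,d) that is mapped to a vertex.\<close>
  have "p \<le> c" using no_vertex[of p u] path_Ed_boundary(1)[OF x Ed] cd *(3) by force
  moreover have "d \<le> q" using no_vertex[of q w] path_Ed_boundary(2)[OF x Ed] cd *(4) by force
  ultimately have sub: "{c..d} \<subseteq> {p..q}" by auto
  have pq: "p < q" using *(3,4) by simp
  let ?f = "\<lambda>s. (s - p) / (q - p)"
  have "path s = edge_param a b (?f s)" if "s \<in> {c..d}" for s
  proof -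
    have "s \<in> {p..q}" using that sub by blast
    then consider "s = p" | "s = q" | "s \<in> {p<..<q}" unfolding atLeastAtMost_iff greaterThanLessThan_iff by linarith
    then show ?thesis
    proof cases
      case 1
      then show ?thesis using path_Ed_boundary(1)[OF x Ed] by (simp add: edge_param_def eq)
    next
      case 2
      then show ?thesis using path_Ed_boundary(2)[OF x Ed] pq by (simp add: edge_param_def eq)
    next
      case 3
      then show ?thesis using path_Ed_on[OF x Ed 3] by (simp add: edge_param_def eq)
    qed
  qed
  moreover have "mono_on {c..d} ?f" using pq by (intro mono_onI divide_right_mono) auto
  moreover have "?f ` {c..d} \<subseteq> {0..1}" using sub pq by (auto simp: divide_le_eq)
  ultimately show "\<exists>f. mono_on {c..d} f \<and> f ` {c..d} \<subseteq> {0..1} \<and> (\<forall>s\<in>{c..d}. path s = edge_param a b (f s))"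
    by blast
qed

section \<open>Closedness and the vertices visited\<close>

lemma path_closed: "path 0 = path 1"
proof -
  obtain p q where "st 0 0 = Blk (e 0) 0 q" "st 0 1 = Blk (e 0) p 1" by simp
  then show ?thesis using path_boundary[of 0 0 "e 0" 0 q] path_boundary[of 1 0 "e 0" p 1] by simp
qed

text \<open>The walk inserted into a block whose class contains v meets the next class of v, so the
  induction passes from each stage to the next.\<close>

lemma part_visited:
  assumes "v \<in> V"
  shows "\<exists>x\<in>{0..1}. \<exists>c p q. st n x = Blk c p q \<and> v \<in> part n c"
proof (induction n)
  case 0
  then show ?case using assms part_0[OF e_in_V] by (intro bexI[of _ 0]) auto
next
  case (Suc n)
  then obtain x c p q where x: "x \<in> {0..1}" and st: "st n x = Blk c p q" and v: "v \<in> part n c" by blast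
  note * = tracks_Blk[OF st_tracks x st]
  obtain c' where c': "c' \<in> set (refine n c)" "v \<in> part (Suc n) c'"
    using refine_props(2)[OF st_vertex_in_V[OF st] v] by blast
  obtain y p' q' where y: "y \<in> {p..q}" "locate p q (refine n c) y = Blk c' p' q'"
    using locate_hits[OF *(2) c'(1)] by blast
  have "st (Suc n) y = Blk c' p' q'" using *(6)[OF y(1)] y(2) by simp
  moreover have "y \<in> {0..1}" using y(1) *(1,3) by auto
  ultimately show ?case using c'(2) by blast
qed

text \<open>Once v is in X n its class is {v}, so the block supplied by \<open>part_visited\<close>
  is a visit to v itself.\<close>

lemma path_visits:
  assumes "v \<in> V"
  shows "Pt (Vx v) \<in> path ` {0..1}"
proof -
  obtain n where n: "v \<in> X n" using vertex_in_X assms by blast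
  obtain x c p q where x: "x \<in> {0..1}" and st: "st n x = Blk c p q" and v: "v \<in> part n c"
    using part_visited[OF assms] by blast
  have c: "c \<in> X n" using part_disjoint_X[OF _ v] n by blast
  then have "c = v" using v part_X by simp
  then show ?thesis using path_vertex[OF x st c] x by (metis imageI)
qed

end

theorem theorem4:
  fixes V :: "'v set" and E :: "('v \<times> 'v) set"
  assumes "digraph V E" and "V \<noteq> {}" and "countable V" and "solid V E"
  shows "strongly_connected V E \<longleftrightarrow>
    (\<exists>\<alpha>. dtop_path V E \<alpha> \<and> \<alpha> 0 = \<alpha> 1 \<and> (\<forall>v\<in>V. Pt (Vx v) \<in> \<alpha> ` {0..1}))"
proof
  assume connected: "strongly_connected V E"
  \<comment> \<open>For nonempty countable V the range of \<open>from_nat_into V\<close> is exactly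
    V.\<close>
  interpret enumerated_digraph V E "from_nat_into V"
    using assms connected by unfold_locales simp_all
  show "\<exists>\<alpha>. dtop_path V E \<alpha> \<and> \<alpha> 0 = \<alpha> 1 \<and> (\<forall>v\<in>V. Pt (Vx v) \<in> \<alpha> ` {0..1})"
    using dtop_path_path path_closed path_visits by blast
next
  assume "\<exists>\<alpha>. dtop_path V E \<alpha> \<and> \<alpha> 0 = \<alpha> 1 \<and> (\<forall>v\<in>V. Pt (Vx v) \<in> \<alpha> ` {0..1})"
  then show "strongly_connected V E" using strongly_connected_if_dtop_path by blast
qed

end
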